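(* Let $q$ be a prime power. For every $m\ge2$ and $1\le k\le q-1$, there is a bijection between $\mathrm{PDeg}_q(m,k)$ and the disjoint union $\mathrm{PDeg}_q(m-1,k)\sqcup\mathrm{ADeg}_q(m,k-1)$.
   Context: Projective side. $\mathbb P^m=(\mathbb F_q^{m+1}\setminus\{0\})/\mathbb F_q^\times$; the standard representative of a point is the one whose leftmost non-zero coordinate is $1$. $\mathbb F_q[\mathbf X]^H_v$ is the space of homogeneous polynomials of degree $v$ in $X_0,\dots,X_m$ (together with $0$), and $\mathrm{ev}_{\mathbb P^m}(f)=(f(\mathbf P))_{\mathbf P\in\mathbb P^m}$, evaluating at standard representatives. $\mathrm{PRS}_q(k)=\{\mathrm{ev}_{\mathbb P^1}(g): g\in\mathbb F_q[S,T]^H_k\}$. $\mathrm{Emb}_{\mathbb P}(m)$ is the set of injective $\mathbb F_q$-linear maps $L:\mathbb F_q^2\to\mathbb F_q^{m+1}$, and $f\circ L=f(L(S,T))$. For $m\ge1$, $1\le k\le q-1$ and $v=k+(m-1)(q-1)$, $$\mathrm{PLift}_q(m,k)=\{\mathrm{ev}_{\mathbb P^m}(f): f\in\mathbb F_q[\mathbf X]^H_v,\ \forall L\in\mathrm{Emb}_{\mathbb P}(m),\ \mathrm{ev}_{\mathbb P^1}(f\circ L)\in\mathrm{PRS}_q(k)\}.$$ Affine side. For $f\in\mathbb F_q[X_1,\dots,X_m]$, $\mathrm{ev}_{\mathbb A^m}(f)=(f(\mathbf x))_{\mathbf x\in\mathbb F_q^m}$. $\mathrm{RS}_q(k)=\{\mathrm{ev}_{\mathbb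 A^1}(g): g\in\mathbb F_q[T],\deg g\le k\}$. $\mathrm{Emb}_{\mathbb A}(m)$ is the set of linear maps $L^*=(L_1,\dots,L_m):\mathbb F_q^2\to\mathbb F_q^m$ for which some $L_0$ makes $(L_0,\dots,L_m)$ an element of $\mathrm{Emb}_{\mathbb P}(m)$; $f\circ L^*$ is the univariate polynomial $f(L^*(1,T))$. For $m\ge1$, $0\le k\le q-2$, $$\mathrm{Lift}_q(m,k)=\{\mathrm{ev}_{\mathbb A^m}(f): f\in\mathbb F_q[X_1,\dots,X_m],\ \forall L\in\mathrm{Emb}_{\mathbb A}(m),\ \mathrm{ev}_{\mathbb A^1}(f\circ L)\in\mathrm{RS}_q(k)\}.$$ Degree sets. $S^{m+1}(v)=\{\mathbf d\in\mathbb N^{m+1}:\sum d_i=v\}$ and $\mathrm{Poly}(D)=\langle\mathbf X^{\mathbf d}:\mathbf d\in D\rangle_{\mathbb F_q}$. A tuple $\mathbf d\in\mathbb N^m$ is $A$-reduced if all $d_i\le q-1$. A tuple $\mathbf d\in\mathbb N^{m+1}$ is $P$-reduced if for every $i$, $d_i\ge q$ implies $d_j=0$ for all $j<i$ and $d_j\le q-1$ for all $j>i$. The codes $\mathrm{Lift}_q(m,k)$ and $\mathrm{PLift}_q(m,k)$ are spanned by evaluations of monomials. $\mathrm{ADeg}_q(m,k)$ is the unique set $D\subseteq\mathbb N^m$ of $A$-reduced tuples with $\mathrm{Lift}_q(m,k)=\mathrm{ev}_{\mathbb A^m}(\mathrm{Poly}(D))$; $\mathrm{PDeg}_q(m,k)$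 is the unique set $D\subseteq S^{m+1}(v)$, $v=k+(m-1)(q-1)$, of $P$-reduced tuples with $\mathrm{PLift}_q(m,k)=\mathrm{ev}_{\mathbb P^m}(\mathrm{Poly}(D))$. *)

theory Defs
  imports
    "HOL-Library.Cardinality"
    "HOL-Library.FuncSet"
    "HOL-Library.Poly_Mapping"
    "HOL-Library.Function_Algebras"
    "HOL-Library.Product_Plus"
    "HOL-Computational_Algebra.Polynomial"
begin

text \<open>
  The field \<open>F_q\<close> is an arbitrary finite field \<open>'a :: {field, finite}\<close>, and \<open>q = CARD('a)\<close>.
  The dimension \<open>m\<close> varies inside the definitions, so a vector with coordinates indexed by a finite
  set \<open>I\<close> of natural numbers is a function \<open>nat \<Rightarrow> 'a\<close> that is zero outside \<open>I\<close>, and a tuple of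
  exponents indexed by \<open>I\<close> is an element of \<open>nat \<Rightarrow>\<^sub>0 nat\<close> whose support is contained in \<open>I\<close>.
  The index set is \<open>{..m}\<close> on the projective side and \<open>{1..m}\<close> on the affine side.
\<close>

type_synonym exponents = "nat \<Rightarrow>\<^sub>0 nat"
type_synonym 'a mpoly = "exponents \<Rightarrow>\<^sub>0 'a"

definition vectors :: "nat set \<Rightarrow> (nat \<Rightarrow> 'a::zero) set" where
  "vectors I = {x. \<forall>i. i \<notin> I \<longrightarrow> x i = 0}"

definition tuples :: "nat set \<Rightarrow> exponents set" where
  "tuples I = {d. Poly_Mapping.keys d \<subseteq> I}"


subsection \<open>Multivariate polynomials\<close>

definition mpolys :: "nat set \<Rightarrow> 'a::zero mpoly set" where
  "mpolys I = {f. Poly_Mapping.keys f \<subseteq> tuples I}"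

definition simplex :: "nat \<Rightarrow> nat \<Rightarrow> exponents set" where
  "simplex m v = {d \<in> tuples {..m}. (\<Sum>i\<le>m. Poly_Mapping.lookup d i) = v}"

definition hom_polys :: "nat \<Rightarrow> nat \<Rightarrow> 'a::zero mpoly set" where
  "hom_polys m v = {f. Poly_Mapping.keys f \<subseteq> simplex m v}"

text \<open>
  \<open>substitute h x f\<close> applies the coefficient map \<open>h\<close> to \<open>f\<close> and substitutes \<open>x i\<close> for the
  \<open>i\<close>-th variable.
\<close>

definition substitute :: "('a::zero \<Rightarrow> 'r::comm_semiring_1) \<Rightarrow> (nat \<Rightarrow> 'r) \<Rightarrow> 'a mpoly \<Rightarrow> 'r" where
  "substitute h x f = (\<Sum>d\<in>Poly_Mapping.keys f. h (Poly_Mapping.lookup f d) *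
      (\<Prod>i\<in>Poly_Mapping.keys d. x i ^ Poly_Mapping.lookup d i))"

definition mpoly_eval :: "'a::comm_semiring_1 mpoly \<Rightarrow> (nat \<Rightarrow> 'a) \<Rightarrow> 'a" where
  "mpoly_eval f x = substitute (\<lambda>c. c) x f"

abbreviation Const :: "'a::zero \<Rightarrow> 'a mpoly" where
  "Const c \<equiv> Poly_Mapping.single 0 c"

abbreviation Var :: "nat \<Rightarrow> 'a::zero_neq_one mpoly" where
  "Var i \<equiv> Poly_Mapping.single (Poly_Mapping.single i 1) 1"

definition Poly_span :: "exponents set \<Rightarrow> 'a::comm_monoid_add mpoly set" where
  "Poly_span D = {\<Sum>d\<in>E. Poly_Mapping.single d (c d) | E c. finite E \<and> E \<subseteq> D}"


subsection \<open>Linear maps\<close>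

text \<open>
  Vector space operations on pairs and on functions are the componentwise ones.
\<close>

definition linear_map :: "('a::field \<times> 'a \<Rightarrow> nat \<Rightarrow> 'a) \<Rightarrow> bool" where
  "linear_map L \<longleftrightarrow>
    Vector_Spaces.linear (\<lambda>c p. (c * fst p, c * snd p)) (\<lambda>c x i. c * x i) L"

definition Emb_P :: "nat \<Rightarrow> ('a::field \<times> 'a \<Rightarrow> nat \<Rightarrow> 'a) set" where
  "Emb_P m = {L. linear_map L \<and> range L \<subseteq> vectors {..m} \<and> inj L}"

definition Emb_A :: "nat \<Rightarrow> ('a::field \<times> 'a \<Rightarrow> nat \<Rightarrow> 'a) set" where
  "Emb_A m = {L. linear_map L \<and> range L \<subseteq> vectors {1..m} \<and>
    (\<exists>L0. (\<lambda>p. (L p)(0 := L0 p)) \<in> Emb_P m)}"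

text \<open>
  The \<open>i\<close>-th coordinate of \<open>L\<close> is the linear form \<open>L(1,0)\<^sub>i S + L(0,1)\<^sub>i T\<close>. The bivariate
  polynomial \<open>f(L(S,T))\<close> is written with \<open>S = Var 0\<close> and \<open>T = Var 1\<close>, so that it can be
  evaluated on the projective line; \<open>f(L(1,T))\<close> is a univariate polynomial.
\<close>

definition comp_P :: "'a::field mpoly \<Rightarrow> ('a \<times> 'a \<Rightarrow> nat \<Rightarrow> 'a) \<Rightarrow> 'a mpoly" where
  "comp_P f L =
    substitute Const (\<lambda>i. Const (L (1, 0) i) * Var 0 + Const (L (0, 1) i) * Var 1) f"

definition comp_A :: "'a::field mpoly \<Rightarrow> ('a \<times> 'a \<Rightarrow> nat \<Rightarrow> 'a) \<Rightarrow> 'a poly" where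
  "comp_A f L = substitute (\<lambda>c. [:c:]) (\<lambda>i. [:L (1, 0) i, L (0, 1) i:]) f"


subsection \<open>Projective codes\<close>

text \<open>
  Every point of projective space has exactly one standard representative, so the
  coordinates of a codeword are indexed by the standard representatives. Codewords are functions
  that are \<open>undefined\<close> outside the set of evaluation points.
\<close>

definition proj_points :: "nat \<Rightarrow> (nat \<Rightarrow> 'a::zero_neq_one) set" where
  "proj_points m = {x \<in> vectors {..m}. \<exists>i\<le>m. x i = 1 \<and> (\<forall>j<i. x j = 0)}"

definition ev_P :: "nat \<Rightarrow> 'a::field mpoly \<Rightarrow> (nat \<Rightarrow> 'a) \<Rightarrow> 'a" where
  "ev_P m f = restrict (mpoly_eval f) (proj_points m)"

definition PRS :: "nat \<Rightarrow> ((nat \<Rightarrow> 'a::field) \<Rightarrow> 'a) set" where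
  "PRS k = ev_P 1 ` hom_polys 1 k"

definition PLift :: "nat \<Rightarrow> nat \<Rightarrow> ((nat \<Rightarrow> 'a::{field,finite}) \<Rightarrow> 'a) set" where
  "PLift m k = {ev_P m f | f. f \<in> hom_polys m (k + (m - 1) * (CARD('a) - 1)) \<and>
    (\<forall>L \<in> Emb_P m. ev_P 1 (comp_P f L) \<in> PRS k)}"


subsection \<open>Affine codes\<close>

definition ev_A :: "nat \<Rightarrow> 'a::field mpoly \<Rightarrow> (nat \<Rightarrow> 'a) \<Rightarrow> 'a" where
  "ev_A m f = restrict (mpoly_eval f) (vectors {1..m})"

text \<open>On the affine line the evaluation vector of \<open>g\<close> is the function \<open>poly g\<close>.\<close>

definition RS :: "nat \<Rightarrow> ('a::field \<Rightarrow> 'a) set" where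
  "RS k = {poly g | g. degree g \<le> k}"

definition Lift :: "nat \<Rightarrow> nat \<Rightarrow> ((nat \<Rightarrow> 'a::field) \<Rightarrow> 'a) set" where
  "Lift m k = {ev_A m f | f. f \<in> mpolys {1..m} \<and>
    (\<forall>L \<in> Emb_A m. poly (comp_A f L) \<in> RS k)}"


subsection \<open>Degree sets\<close>

definition A_reduced :: "nat \<Rightarrow> nat \<Rightarrow> exponents \<Rightarrow> bool" where
  "A_reduced q m d \<longleftrightarrow> (\<forall>i\<in>{1..m}. Poly_Mapping.lookup d i \<le> q - 1)"

definition P_reduced :: "nat \<Rightarrow> nat \<Rightarrow> exponents \<Rightarrow> bool" where
  "P_reduced q m d \<longleftrightarrow> (\<forall>i\<le>m. q \<le> Poly_Mapping.lookup d i \<longrightarrow>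
    (\<forall>j<i. Poly_Mapping.lookup d j = 0) \<and>
    (\<forall>j\<in>{i<..m}. Poly_Mapping.lookup d j \<le> q - 1))"

text \<open>
  The degree sets do not mention the field in their type, hence the \<open>itself\<close> argument.
\<close>

definition ADeg :: "'a::{field,finite} itself \<Rightarrow> nat \<Rightarrow> nat \<Rightarrow> exponents set" where
  "ADeg _ m k = (THE D. D \<subseteq> {d \<in> tuples {1..m}. A_reduced CARD('a) m d} \<and>
    (Lift m k :: ((nat \<Rightarrow> 'a) \<Rightarrow> 'a) set) = ev_A m ` Poly_span D)"

definition PDeg :: "'a::{field,finite} itself \<Rightarrow> nat \<Rightarrow> nat \<Rightarrow> exponents set" where
  "PDeg _ m k = (THE D.
    D \<subseteq> {d \<in> simplex m (k + (m - 1) * (CARD('a) - 1)). P_reduced CARD('a) m d} \<and>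
    (PLift m k :: ((nat \<Rightarrow> 'a) \<Rightarrow> 'a) set) = ev_P m ` Poly_span D)"

end

theory Submission
  imports Defs "HOL-Combinatorics.Transposition"
begin

text \<open>
  A word of \<open>PLift\<^sub>q(m, k)\<close> extends to a function on \<open>F\<^sub>q\<^sup>m\<^sup>+\<^sup>1\<close> that is a binary form of degree \<open>k\<close>
  along every, possibly degenerate, pair of vectors. These functions are closed under all diagonal
  scalings, including those with zero entries, and such scalings separate the exponents
  \<open>0, \<dots>, q - 1\<close>; hence the codes are spanned by monomials. Since reducing exponents modulo
  \<open>q - 1\<close> does not change the functions, \<open>PDeg\<^sub>q(m, k)\<close> corresponds to the exponents
  \<open>e \<in> {0, \<dots>, q - 1}\<^sup>m\<^sup>+\<^sup>1\<close> whose monomial has this property. Those with \<open>e\<^sub>0 = 0\<close> correspond to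
  \<open>PDeg\<^sub>q(m - 1, k)\<close>. If \<open>e\<^sub>0 > 0\<close>, the form vanishes at infinity and dehomogenizing yields an
  element of \<open>ADeg\<^sub>q(m, k - 1)\<close>, from which \<open>e\<^sub>0 \<in> {1, \<dots>, q - 1}\<close> is recovered by the congruence
  of the total degree with \<open>k\<close> modulo \<open>q - 1\<close>.
\<close>

abbreviation lookup :: "('b \<Rightarrow>\<^sub>0 'c::zero) \<Rightarrow> 'b \<Rightarrow> 'c" where
  "lookup \<equiv> Poly_Mapping.lookup"

abbreviation keys :: "('b \<Rightarrow>\<^sub>0 'c::zero) \<Rightarrow> 'b set" where
  "keys \<equiv> Poly_Mapping.keys"

subsection \<open>Powers in a finite field\<close>

lemma card_field_ge_2: "CARD('a::{field,finite}) \<ge> 2"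
proof -
  have "card {0, 1 :: 'a} \<le> CARD('a)"
    by (intro card_mono) auto
  then show ?thesis
    by simp
qed

text \<open>Multiplication by \<open>x\<close> permutes the non-zero elements, so their product
  equals \<open>x ^ (q - 1)\<close> times itself and can be cancelled.\<close>

lemma power_card_minus_one:
  fixes x :: "'a::{field,finite}"
  assumes "x \<noteq> 0"
  shows "x ^ (CARD('a) - 1) = 1"
proof -
  have "(\<Prod>y\<in>UNIV-{0}. x * y) = x ^ (CARD('a) - 1) * \<Prod>(UNIV-{0})"
    by (simp add: prod.distrib)
  moreover have "(\<Prod>y\<in>UNIV-{0}. x * y) = \<Prod>(UNIV-{0})"
    by (rule prod.reindex_bij_witness[of _ "\<lambda>y. y / x" "\<lambda>y. x * y"]) (use assms in auto)
  ultimately show ?thesis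
    by simp
qed

text \<open>
  The representative of \<open>n\<close> modulo \<open>q - 1\<close> in \<open>{1..q - 1}\<close>, except that \<open>0\<close> is kept apart:
  \<open>x ^ 0\<close> and \<open>x ^ (q - 1)\<close> differ at \<open>x = 0\<close>.
\<close>

definition exp_reduce :: "nat \<Rightarrow> nat \<Rightarrow> nat" where
  "exp_reduce q n = (if n = 0 then 0 else (n - 1) mod (q - 1) + 1)"

lemma exp_reduce_0 [simp]: "exp_reduce q 0 = 0"
  by (simp add: exp_reduce_def)

lemma exp_reduce_eq_0_iff [simp]: "exp_reduce q n = 0 \<longleftrightarrow> n = 0"
  by (simp add: exp_reduce_def)

lemma exp_reduce_le_card:
  assumes "q \<ge> 2"
  shows "exp_reduce q n \<le> q - 1"
  using assms pos_mod_bound[of "q - 1" "n - 1"] mod_less_divisor[of "q - 1" "n - 1"]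
  by (auto simp: exp_reduce_def Suc_le_eq simp del: mod_less_divisor)

lemma exp_reduce_id: "n \<le> q - 1 \<Longrightarrow> exp_reduce q n = n"
  by (auto simp: exp_reduce_def)

lemma exp_reduce_decomp: "\<exists>c. n = exp_reduce q n + c * (q - 1)"
proof (cases "n = 0")
  case False
  have "n - 1 = (n - 1) mod (q - 1) + (n - 1) div (q - 1) * (q - 1)"
    by (rule mod_div_mult_eq[symmetric])
  with False have "n = exp_reduce q n + (n - 1) div (q - 1) * (q - 1)"
    unfolding exp_reduce_def if_not_P[OF False] by linarith
  then show ?thesis ..
qed simp

lemma exp_reduce_le: "exp_reduce q n \<le> n"
  by (metis exp_reduce_decomp le_add1)

lemma exp_reduce_mod: "exp_reduce q n mod (q - 1) = n mod (q - 1)"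
proof -
  obtain c where "n = exp_reduce q n + c * (q - 1)"
    using exp_reduce_decomp by blast
  then show ?thesis
    by (metis mod_mult_self1)
qed

lemma exp_reduce_add_mult:
  assumes "n > 0"
  shows "exp_reduce q (n + c * (q - 1)) = exp_reduce q n"
proof -
  have "n + c * (q - 1) - 1 = (n - 1) + c * (q - 1)"
    using assms by simp
  then have "(n + c * (q - 1) - 1) mod (q - 1) = (n - 1) mod (q - 1)"
    by (simp only: mod_mult_self1)
  then show ?thesis
    using assms by (simp add: exp_reduce_def del: One_nat_def)
qed

text \<open>Positivity excludes \<open>0\<close>, which is congruent to \<open>q - 1\<close> but has
  a representative of its own.\<close>

lemma exp_reduce_cong:
  assumes "a > 0" "b > 0" "a mod (q - 1) = b mod (q - 1)"
  shows "exp_reduce q a = exp_reduce q b"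
proof -
  have "exp_reduce q b = exp_reduce q a" if "0 < a" "a \<le> b" "a mod (q - 1) = b mod (q - 1)" for a b
  proof -
    have "(q - 1) dvd b - a"
      using that by (metis mod_eq_dvd_iff_nat)
    then obtain c where "b - a = c * (q - 1)"
      by (metis dvd_def mult.commute)
    then have "b = a + c * (q - 1)"
      using that by simp
    then show ?thesis
      using exp_reduce_add_mult[OF that(1)] by simp
  qed
  then show ?thesis
    by (metis assms nat_le_linear)
qed

lemma power_exp_reduce:
  fixes x :: "'a::{field,finite}"
  shows "x ^ exp_reduce CARD('a) n = x ^ n"
proof (cases "x = 0")
  case True
  then show ?thesis
    by (simp add: power_0_left)
next
  case False
  obtain c where "n = exp_reduce CARD('a) n + c * (CARD('a) - 1)"
    using exp_reduce_decomp by blast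
  then have "x ^ n = x ^ exp_reduce CARD('a) n * (x ^ (CARD('a) - 1)) ^ c"
    by (metis power_add power_mult mult.commute)
  then show ?thesis
    using power_card_minus_one[OF False] by simp
qed

text \<open>A non-zero difference would have degree below \<open>q\<close> but \<open>q\<close>
  roots.\<close>

lemma degree_less_card_eqI:
  fixes f g :: "'a::{field,finite} poly"
  assumes "degree f \<le> CARD('a) - 1" "degree g \<le> CARD('a) - 1" "\<And>x. poly f x = poly g x"
  shows "f = g"
  using assms card_field_ge_2[where 'a='a] by (intro poly_eqI_degree[of UNIV]) auto

text \<open>Reduced exponents give monomials of degree at most \<open>q - 1\<close>, and such
  polynomials are determined by their values.\<close>

lemma power_eq_imp_exp_reduce_eq:
  assumes "\<And>x::'a::{field,finite}. x ^ i = x ^ j"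
  shows "exp_reduce CARD('a) i = exp_reduce CARD('a) j"
proof -
  let ?r = "exp_reduce CARD('a)"
  have "monom (1::'a) (?r i) = monom 1 (?r j)"
    using assms
    by (intro degree_less_card_eqI)
      (auto simp: degree_monom_eq poly_monom power_exp_reduce exp_reduce_le_card card_field_ge_2
        simp del: One_nat_def)
  then have "degree (monom (1::'a) (?r i)) = degree (monom (1::'a) (?r j))"
    by simp
  then show ?thesis
    by (simp add: degree_monom_eq)
qed

text \<open>The weights are the coefficients of the Lagrange basis \<open>1 - (X - c) ^ (q - 1)\<close>.\<close>

lemma coeff_extraction_weights:
  assumes "n \<le> CARD('a) - 1"
  shows "\<exists>w :: 'a::{field,finite} \<Rightarrow> 'a. \<forall>e \<le> CARD('a) - 1.
    (\<Sum>c\<in>UNIV. w c * c ^ e) = (if e = n then 1 else 0)"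
proof (intro exI allI impI)
  fix e assume e: "e \<le> CARD('a) - 1"
  \<comment> \<open>Since non-zero elements have \<open>(q - 1)\<close>-st power 1,
    \<open>\<delta> c\<close> is the indicator function of \<open>c\<close>.\<close>
  define \<delta> :: "'a \<Rightarrow> 'a poly" where "\<delta> c = 1 - [:-c, 1:] ^ (CARD('a) - 1)" for c
  have deg: "degree (\<delta> c) \<le> CARD('a) - 1" for c
    unfolding \<delta>_def
    by (intro degree_diff_le) (auto simp: degree_linear_power)
  have eval: "poly (\<delta> c) x = (if x = c then 1 else 0)" for c x
    using card_field_ge_2[where 'a='a] power_card_minus_one[of "x - c"]
    by (auto simp: \<delta>_def power_0_left)
  \<comment> \<open>Lagrange interpolation of the \<open>e\<close>-th power on the whole field;
    comparing the coefficients of index \<open>n\<close> gives the claim.\<close>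
  have "(\<Sum>c\<in>UNIV. smult (c ^ e) (\<delta> c)) = monom 1 e"
  proof (rule degree_less_card_eqI)
    show "degree (\<Sum>c\<in>UNIV. smult (c ^ e) (\<delta> c)) \<le> CARD('a) - 1"
      using deg by (intro degree_sum_le) (auto intro: order_trans[OF degree_smult_le])
    show "degree (monom (1::'a) e) \<le> CARD('a) - 1"
      using e by (simp add: degree_monom_eq)
    show "poly (\<Sum>c\<in>UNIV. smult (c ^ e) (\<delta> c)) x = poly (monom 1 e) x" for x
      by (simp add: poly_sum eval poly_monom if_distrib[of "(*) _"] cong: if_cong)
  qed
  from arg_cong[OF this, of "\<lambda>p. coeff p n"]
  show "(\<Sum>c\<in>UNIV. coeff (\<delta> c) n * c ^ e) = (if e = n then 1 else 0)"
    by (simp add: coeff_sum mult.commute)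
qed


subsection \<open>Monomials as functions\<close>

text \<open>
  Monomials are evaluated at arbitrary functions \<open>nat \<Rightarrow> 'a\<close>, whatever their support, so that
  the ambient dimension disappears from most statements.
\<close>

definition mon :: "exponents \<Rightarrow> (nat \<Rightarrow> 'a::comm_semiring_1) \<Rightarrow> 'a" where
  "mon d x = (\<Prod>i\<in>keys d. x i ^ lookup d i)"

definition total_degree :: "exponents \<Rightarrow> nat" where
  "total_degree d = (\<Sum>i\<in>keys d. lookup d i)"

definition reduce :: "nat \<Rightarrow> exponents \<Rightarrow> exponents" where
  "reduce q = Poly_Mapping.map (exp_reduce q)"

definition reduced :: "nat \<Rightarrow> exponents \<Rightarrow> bool" where
  "reduced q d \<longleftrightarrow> (\<forall>i. lookup d i \<le> q - 1)"

lemma mon_superset: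
  assumes "finite A" "keys d \<subseteq> A"
  shows "mon d x = (\<Prod>i\<in>A. x i ^ lookup d i)"
  unfolding mon_def using assms
  by (intro prod.mono_neutral_left) (auto simp: in_keys_iff)

lemma total_degree_superset:
  assumes "finite A" "keys d \<subseteq> A"
  shows "total_degree d = (\<Sum>i\<in>A. lookup d i)"
  unfolding total_degree_def using assms
  by (intro sum.mono_neutral_left) (auto simp: in_keys_iff)

lemma mon_cong: "(\<And>i. i \<in> keys d \<Longrightarrow> x i = y i) \<Longrightarrow> mon d x = mon d y"
  unfolding mon_def by (intro prod.cong) auto

lemma mon_add: "mon (d + e) x = mon d x * mon e x"
proof -
  have "mon (d + e) x = (\<Prod>i\<in>keys d \<union> keys e. x i ^ lookup (d + e) i)"
    by (rule mon_superset) (auto dest: subsetD[OF Poly_Mapping.keys_add])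
  also have "\<dots> = mon d x * mon e x"
    by (simp add: lookup_add power_add prod.distrib mon_superset[of "keys d \<union> keys e"])
  finally show ?thesis .
qed

lemma total_degree_add: "total_degree (d + e) = total_degree d + total_degree e"
proof -
  have "total_degree (d + e) = (\<Sum>i\<in>keys d \<union> keys e. lookup (d + e) i)"
    by (rule total_degree_superset) (auto dest: subsetD[OF Poly_Mapping.keys_add])
  also have "\<dots> = total_degree d + total_degree e"
    by (simp add: lookup_add sum.distrib total_degree_superset[of "keys d \<union> keys e"])
  finally show ?thesis .
qed

lemma mon_0 [simp]: "mon 0 x = 1"
  by (simp add: mon_def)

lemma mon_single [simp]: "mon (Poly_Mapping.single i n) x = x i ^ n"
  by (cases "n = 0") (auto simp: mon_def)

lemma total_degree_single [simp]: "total_degree (Poly_Mapping.single i n) = n"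
  by (cases "n = 0") (auto simp: total_degree_def)

lemma mon_mult: "mon d (\<lambda>i. x i * y i) = mon d x * mon d y"
  by (simp add: mon_def power_mult_distrib prod.distrib)

lemma mon_const: "mon d (\<lambda>i. c) = c ^ total_degree d"
  by (simp add: mon_def total_degree_def power_sum)

lemma total_degree_0_iff: "total_degree d = 0 \<longleftrightarrow> keys d = {}"
  unfolding total_degree_def by (subst sum_eq_0_iff) (auto simp del: keys_eq_empty simp: in_keys_iff)

lemma lookup_reduce [simp]: "lookup (reduce q d) i = exp_reduce q (lookup d i)"
  by (simp add: reduce_def map.rep_eq when_def)

lemma keys_reduce [simp]: "keys (reduce q d) = keys d"
  by (auto simp: in_keys_iff)

lemma mon_reduce: "mon (reduce CARD('a) d) (x :: nat \<Rightarrow> 'a::{field,finite}) = mon d x"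
  by (simp add: mon_def power_exp_reduce)

lemma reduce_id: "reduced q d \<Longrightarrow> reduce q d = d"
  by (intro poly_mapping_eqI) (simp add: reduced_def exp_reduce_id)

lemma reduced_reduce: "q \<ge> 2 \<Longrightarrow> reduced q (reduce q d)"
  by (simp add: reduced_def exp_reduce_le_card del: One_nat_def)

text \<open>Used later to see that a reduced exponent can be raised back to the degree it came
  from.\<close>

lemma total_degree_reduce_decomp:
  "\<exists>c. total_degree d = total_degree (reduce q d) + c * (q - 1)"
proof -
  define c where "c n = (SOME c. n = exp_reduce q n + c * (q - 1))" for n
  have c: "n = exp_reduce q n + c n * (q - 1)" for n
    unfolding c_def by (rule someI_ex) (rule exp_reduce_decomp)
  have "total_degree d = (\<Sum>i\<in>keys d. exp_reduce q (lookup d i) + c (lookup d i) * (q - 1))"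
    unfolding total_degree_def using c by (intro sum.cong) auto
  also have "\<dots> = total_degree (reduce q d) + (\<Sum>i\<in>keys d. c (lookup d i)) * (q - 1)"
    by (simp add: sum.distrib total_degree_def sum_distrib_right)
  finally show ?thesis
    by blast
qed

lemma finite_reduced: "finite I \<Longrightarrow> finite {d \<in> tuples I. reduced q d}"
proof -
  assume I: "finite I"
  have "finite {f. \<forall>i. (i \<in> I \<longrightarrow> f i \<in> {..q - 1}) \<and> (i \<notin> I \<longrightarrow> f i = (0::nat))}"
    using I by (intro finite_set_of_finite_funs) auto
  moreover have "lookup ` {d \<in> tuples I. reduced q d} \<subseteq>
      {f. \<forall>i. (i \<in> I \<longrightarrow> f i \<in> {..q - 1}) \<and> (i \<notin> I \<longrightarrow> f i = 0)}"
    by (auto simp: tuples_def reduced_def in_keys_iff)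
  ultimately have "finite (lookup ` {d \<in> tuples I. reduced q d})"
    using finite_subset by blast
  then show ?thesis
    by (rule finite_imageD) (auto intro!: inj_onI poly_mapping_eqI)
qed

text \<open>Products of the one-variable weights work: the sum over the grid factors into one sum
  per coordinate, and each factor tests one entry of the exponent.\<close>

lemma monomial_weights:
  assumes "finite I" "e0 \<in> tuples I" "reduced CARD('a::{field,finite}) e0"
  shows "\<exists>w :: (nat \<Rightarrow> 'a) \<Rightarrow> 'a. \<forall>e \<in> tuples I. reduced CARD('a) e \<longrightarrow>
    (\<Sum>c\<in>PiE I (\<lambda>_. UNIV). w c * mon e c) = (if e = e0 then 1 else 0)"
proof -
  obtain u :: "nat \<Rightarrow> 'a \<Rightarrow> 'a" where u: "\<And>n e. n \<le> CARD('a) - 1 \<Longrightarrow> e \<le> CARD('a) - 1 \<Longrightarrow>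
      (\<Sum>c\<in>UNIV. u n c * c ^ e) = (if e = n then 1 else 0)"
    using coeff_extraction_weights[where 'a='a] by metis
  show ?thesis
  proof (intro exI ballI impI)
    fix e assume e: "e \<in> tuples I" "reduced CARD('a) e"
    have "(\<Sum>c\<in>PiE I (\<lambda>_. UNIV). (\<Prod>i\<in>I. u (lookup e0 i) (c i)) * mon e c) =
        (\<Sum>c\<in>PiE I (\<lambda>_. UNIV). \<Prod>i\<in>I. u (lookup e0 i) (c i) * c i ^ lookup e i)"
      using e assms(1) by (simp add: mon_superset[of I] tuples_def prod.distrib)
    also have "\<dots> = (\<Prod>i\<in>I. \<Sum>c\<in>UNIV. u (lookup e0 i) c * c ^ lookup e i)"
      using assms(1) by (intro prod_sum_PiE[symmetric]) auto
    also have "\<dots> = (\<Prod>i\<in>I. if lookup e i = lookup e0 i then 1 else 0)"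
      using e assms(3) by (intro prod.cong) (auto simp: u reduced_def)
    also have "\<dots> = (if \<forall>i\<in>I. lookup e i = lookup e0 i then 1 else 0)"
      using assms(1) by (auto intro: prod_zero)
    also have "(\<forall>i\<in>I. lookup e i = lookup e0 i) \<longleftrightarrow> e = e0"
      using e(1) assms(2)
      by (auto simp: poly_mapping_eq_iff fun_eq_iff tuples_def in_keys_iff) (metis subsetD in_keys_iff)
    finally show "(\<Sum>c\<in>PiE I (\<lambda>_. UNIV). (\<Prod>i\<in>I. u (lookup e0 i) (c i)) * mon e c) =
        (if e = e0 then 1 else 0)" .
  qed
qed


subsection \<open>Codes spanned by monomials\<close>

lemma mpoly_eval_superset:
  assumes "finite D" "keys f \<subseteq> D"
  shows "mpoly_eval f x = (\<Sum>d\<in>D. lookup f d * mon d x)"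
  unfolding mpoly_eval_def substitute_def mon_def using assms
  by (intro sum.mono_neutral_left) (auto simp: in_keys_iff)

lemma mpoly_eval_add: "mpoly_eval (f + g) x = mpoly_eval f x + mpoly_eval g x"
proof -
  have "mpoly_eval (f + g) x = (\<Sum>d\<in>keys f \<union> keys g. lookup (f + g) d * mon d x)"
    by (rule mpoly_eval_superset) (auto dest: subsetD[OF Poly_Mapping.keys_add])
  also have "\<dots> = mpoly_eval f x + mpoly_eval g x"
    by (simp add: lookup_add sum.distrib distrib_right mpoly_eval_superset[of "keys f \<union> keys g"])
  finally show ?thesis .
qed

lemma mpoly_eval_0 [simp]: "mpoly_eval 0 x = 0"
  by (simp add: mpoly_eval_def substitute_def)

lemma mpoly_eval_sum: "mpoly_eval (\<Sum>j\<in>A. f j) x = (\<Sum>j\<in>A. mpoly_eval (f j) x)"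
  by (induction A rule: infinite_finite_induct) (auto simp: mpoly_eval_add)

lemma mpoly_eval_single [simp]: "mpoly_eval (Poly_Mapping.single d c) x = c * mon d x"
  by (cases "c = 0") (auto simp: mpoly_eval_superset[of "{d}"])

lemma sum_single_lookup:
  assumes "finite D" "keys f \<subseteq> D"
  shows "f = (\<Sum>d\<in>D. Poly_Mapping.single d (lookup f d))"
  using assms by (intro poly_mapping_eqI) (auto simp: lookup_sum lookup_single when_def in_keys_iff)

lemma keys_sum_single: "keys (\<Sum>j\<in>A. Poly_Mapping.single (p j) (c j)) \<subseteq> p ` A"
proof (induction A rule: infinite_finite_induct)
  case (insert j A)
  have "keys (\<Sum>j\<in>insert j A. Poly_Mapping.single (p j) (c j)) \<subseteq>
      keys (Poly_Mapping.single (p j) (c j)) \<union> keys (\<Sum>j\<in>A. Poly_Mapping.single (p j) (c j))"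
    unfolding sum.insert[OF insert.hyps] by (rule Poly_Mapping.keys_add)
  then show ?case
    using insert.IH by (auto split: if_splits)
qed auto

lemma mpoly_eval_mult:
  "mpoly_eval (f * g) x = mpoly_eval f x * mpoly_eval g x"
proof -
  have "f * g = (\<Sum>d\<in>keys f. Poly_Mapping.single d (lookup f d)) *
      (\<Sum>e\<in>keys g. Poly_Mapping.single e (lookup g e))"
    using sum_single_lookup[of "keys f" f] sum_single_lookup[of "keys g" g] by simp
  also have "mpoly_eval \<dots> x = (\<Sum>d\<in>keys f. \<Sum>e\<in>keys g.
      (lookup f d * mon d x) * (lookup g e * mon e x))"
    by (simp add: sum_product mult_single mpoly_eval_sum mon_add mult_ac)
  also have "\<dots> = mpoly_eval f x * mpoly_eval g x"
    by (simp add: sum_product mpoly_eval_superset[of "keys f"] mpoly_eval_superset[of "keys g"])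
  finally show ?thesis .
qed

lemma mpoly_eval_1 [simp]: "mpoly_eval 1 x = 1"
  unfolding single_one[symmetric] mpoly_eval_single by simp

lemma mpoly_eval_power: "mpoly_eval (f ^ n) x = mpoly_eval f x ^ n"
  by (induction n) (auto simp: mpoly_eval_mult)

lemma mpoly_eval_prod: "mpoly_eval (\<Prod>j\<in>A. f j) x = (\<Prod>j\<in>A. mpoly_eval (f j) x)"
  by (induction A rule: infinite_finite_induct) (auto simp: mpoly_eval_mult)

lemma Poly_span_iff: "f \<in> Poly_span D \<longleftrightarrow> keys f \<subseteq> D"
proof
  assume "f \<in> Poly_span D"
  then obtain E c where "finite E" "E \<subseteq> D" "f = (\<Sum>d\<in>E. Poly_Mapping.single d (c d))"
    by (auto simp: Poly_span_def)
  then show "keys f \<subseteq> D"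
    by (auto simp: in_keys_iff lookup_sum lookup_single when_def split: if_splits)
next
  assume "keys f \<subseteq> D"
  then show "f \<in> Poly_span D"
    unfolding Poly_span_def using sum_single_lookup[OF finite_keys order_refl, of f]
    by (intro CollectI exI[of _ "keys f"] exI[of _ "lookup f"]) auto
qed

text \<open>The common abstraction of the projective and the affine side: weighted sums over
  diagonal scalings isolate single monomials. Entries of \<open>u\<close> may be zero because the
  weights are indexed by the whole field.\<close>

locale scaling_closed =
  fixes V :: "((nat \<Rightarrow> 'a::{field,finite}) \<Rightarrow> 'a) set"
  assumes zero: "(\<lambda>x. 0) \<in> V"
    and add: "F \<in> V \<Longrightarrow> G \<in> V \<Longrightarrow> (\<lambda>x. F x + G x) \<in> V"
    and scale: "F \<in> V \<Longrightarrow> (\<lambda>x. c * F x) \<in> V"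
    and diag: "F \<in> V \<Longrightarrow> (\<lambda>x. F (\<lambda>i. u i * x i)) \<in> V"
begin

lemma sum: "(\<And>j. j \<in> A \<Longrightarrow> F j \<in> V) \<Longrightarrow> (\<lambda>x. \<Sum>j\<in>A. F j x) \<in> V"
  by (induction A rule: infinite_finite_induct) (auto intro: zero add)

end

text \<open>Scaling the argument by \<open>c\<close> multiplies each monomial by its value at
  \<open>c\<close>, so the weights for the reduction of \<open>d\<close> filter the terms.
  Injectivity of the reduction on \<open>R\<close> ensures that only the term of \<open>d\<close>
  survives.\<close>

lemma extract_coeff:
  fixes f :: "'a::{field,finite} mpoly"
  assumes "finite I" "R \<subseteq> tuples I" "inj_on (reduce CARD('a)) R" "keys f \<subseteq> R" "d \<in> R"
  shows "\<exists>w. \<forall>x. (\<Sum>c\<in>PiE I (\<lambda>_. UNIV). w c * mpoly_eval f (\<lambda>i. c i * x i)) = lookup f d * mon d x"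
proof -
  let ?r = "reduce CARD('a)"
  have mem: "?r e \<in> tuples I" "reduced CARD('a) (?r e)" if "e \<in> R" for e
    using that assms(2) by (auto simp: tuples_def intro: reduced_reduce card_field_ge_2)
  obtain w :: "(nat \<Rightarrow> 'a) \<Rightarrow> 'a" where w: "\<And>e. e \<in> tuples I \<Longrightarrow> reduced CARD('a) e \<Longrightarrow>
      (\<Sum>c\<in>PiE I (\<lambda>_. UNIV). w c * mon e c) = (if e = ?r d then 1 else 0)"
    using monomial_weights[OF assms(1), of "?r d"] mem assms(5) by blast
  have w': "(\<Sum>c\<in>PiE I (\<lambda>_. UNIV). w c * mon e c) = (if e = d then 1 else 0)" if "e \<in> R" for e
    using w[OF mem[OF that]] inj_onD[OF assms(3) _ that assms(5)] by (auto simp: mon_reduce)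
  have "(\<Sum>c\<in>PiE I (\<lambda>_. UNIV). w c * mpoly_eval f (\<lambda>i. c i * x i)) = lookup f d * mon d x" for x
  proof -
    have "(\<Sum>c\<in>PiE I (\<lambda>_. UNIV). w c * mpoly_eval f (\<lambda>i. c i * x i)) =
        (\<Sum>c\<in>PiE I (\<lambda>_. UNIV). \<Sum>e\<in>keys f. lookup f e * mon e x * (w c * mon e c))"
      by (simp add: mpoly_eval_superset[of "keys f"] mon_mult sum_distrib_left mult_ac)
    also have "\<dots> = (\<Sum>e\<in>keys f. lookup f e * mon e x * (\<Sum>c\<in>PiE I (\<lambda>_. UNIV). w c * mon e c))"
      by (subst sum.swap) (simp add: sum_distrib_left)
    also have "\<dots> = (\<Sum>e\<in>keys f. lookup f e * mon e x * (if e = d then 1 else 0))"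
      using assms(4) by (intro sum.cong) (auto simp: w')
    also have "\<dots> = lookup f d * mon d x"
      by (auto simp: in_keys_iff if_distrib[of "(*) _"] cong: if_cong)
    finally show ?thesis .
  qed
  then show ?thesis
    by blast
qed

lemma eq_zero_if_eval_zero:
  fixes f :: "'a::{field,finite} mpoly"
  assumes "finite I" "R \<subseteq> tuples I" "inj_on (reduce CARD('a)) R" "keys f \<subseteq> R"
    and "\<And>x. mpoly_eval f x = 0"
  shows "f = 0"
proof (rule poly_mapping_eqI)
  fix d
  show "lookup f d = lookup 0 d"
  proof (cases "d \<in> R")
    case True
    then obtain w where "\<And>x. (\<Sum>c\<in>PiE I (\<lambda>_. UNIV). w c * mpoly_eval f (\<lambda>i. c i * x i))
        = lookup f d * mon d x"
      using extract_coeff[OF assms(1-4)] by blast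
    \<comment> \<open>Every monomial takes the value 1 at the all-one vector, which leaves the
      coefficient itself.\<close>
    from this[of "\<lambda>_. 1"] show ?thesis
      using assms(5) by (simp add: mon_const)
  qed (use assms(4) in \<open>auto simp: in_keys_iff\<close>)
qed

text \<open>The extraction is a linear combination of scaled copies of the function, so it stays
  inside \<open>V\<close>; dividing by the non-zero coefficient leaves the monomial.\<close>

lemma (in scaling_closed) monomial_mem:
  assumes "finite I" "R \<subseteq> tuples I" "inj_on (reduce CARD('a)) R" "keys f \<subseteq> R"
    and "mpoly_eval f \<in> V" "d \<in> keys f"
  shows "mon d \<in> V"
proof -
  have "d \<in> R"
    using assms by blast
  then obtain w where w: "\<And>x. (\<Sum>c\<in>PiE I (\<lambda>_. UNIV). w c * mpoly_eval f (\<lambda>i. c i * x i))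
      = lookup f d * mon d x"
    using extract_coeff[OF assms(1-4)] by blast
  have "(\<lambda>x. inverse (lookup f d) *
      (\<Sum>c\<in>PiE I (\<lambda>_. UNIV). w c * mpoly_eval f (\<lambda>i. c i * x i))) \<in> V"
    using assms(5) by (intro scale sum diag)
  also have "(\<lambda>x. inverse (lookup f d) *
      (\<Sum>c\<in>PiE I (\<lambda>_. UNIV). w c * mpoly_eval f (\<lambda>i. c i * x i))) = mon d"
    using assms(6) by (auto simp: w in_keys_iff)
  finally show ?thesis .
qed

text \<open>Evaluation on \<open>X\<close> is injective on polynomials supported in
  \<open>R\<close>, so a polynomial supported in \<open>E\<close> with the same values as a monomial
  from \<open>D\<close> is that monomial.\<close>

lemma Poly_span_inj:
  fixes D E :: "exponents set"
  assumes "\<And>f :: 'a::{field,finite} mpoly. keys f \<subseteq> R \<Longrightarrow> (\<And>x. x \<in> X \<Longrightarrow> mpoly_eval f x = 0) \<Longrightarrow> f = 0"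
    and "D \<subseteq> R" "E \<subseteq> R"
    and "(\<lambda>f :: 'a mpoly. restrict (mpoly_eval f) X) ` Poly_span D \<subseteq>
      (\<lambda>f. restrict (mpoly_eval f) X) ` Poly_span E"
  shows "D \<subseteq> E"
proof
  fix d assume d: "d \<in> D"
  let ?f = "Poly_Mapping.single d (1::'a)"
  have "?f \<in> Poly_span D"
    using d by (simp add: Poly_span_iff)
  then obtain g where g: "keys g \<subseteq> E" "restrict (mpoly_eval ?f) X = restrict (mpoly_eval g) X"
    using assms(4) unfolding Poly_span_iff[symmetric] by blast
  have eq: "mpoly_eval ?f x = mpoly_eval g x" if "x \<in> X" for x
    using fun_cong[OF g(2), of x] that by simp
  \<comment> \<open>The difference is written with the constant factor -1 so that the evaluation
    rules for sums and products apply.\<close>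
  let ?h = "?f + Poly_Mapping.single 0 (-1) * g"
  have h: "?h = ?f - g"
    by (simp add: single_uminus)
  have "?h = 0"
  proof (rule assms(1))
    show "keys ?h \<subseteq> R"
      using d subsetD[OF assms(2)] subsetD[OF assms(3)] subsetD[OF g(1)]
      by (auto simp: h in_keys_iff lookup_minus lookup_single when_def split: if_splits)
    show "mpoly_eval ?h x = 0" if "x \<in> X" for x
      using eq[OF that] by (simp only: mpoly_eval_add mpoly_eval_mult) simp
  qed
  then have "g = ?f"
    by (simp add: h)
  then show "d \<in> E"
    using g(1) by simp
qed

text \<open>Serves both degree sets, with \<open>X\<close> the evaluation points of the code.
  Existence holds because membership in \<open>V\<close> can be tested monomial by monomial,
  uniqueness because spans with the same evaluations have the same exponents.\<close>

lemma (in scaling_closed) the_degree_set: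
  fixes R :: "exponents set"
  assumes I: "finite I" "R \<subseteq> tuples I" "inj_on (reduce CARD('a)) R"
    and X: "\<And>f :: 'a mpoly. keys f \<subseteq> R \<Longrightarrow> (\<And>x. x \<in> X \<Longrightarrow> mpoly_eval f x = 0) \<Longrightarrow>
      (\<And>x. mpoly_eval f x = 0)"
    and C: "C = {restrict (mpoly_eval f) X | f. keys f \<subseteq> R \<and> mpoly_eval f \<in> V}"
  shows "(THE D. D \<subseteq> R \<and> C = (\<lambda>f. restrict (mpoly_eval f) X) ` Poly_span D) = {d \<in> R. mon d \<in> V}"
proof -
  let ?D = "{d \<in> R. mon d \<in> V}"
  have inj: "f = 0" if "keys f \<subseteq> R" "\<And>x. x \<in> X \<Longrightarrow> mpoly_eval f x = 0" for f :: "'a mpoly"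
    using eq_zero_if_eval_zero[OF I that(1)] X[OF that] by blast
  have span: "keys f \<subseteq> ?D \<longleftrightarrow> keys f \<subseteq> R \<and> mpoly_eval f \<in> V" for f :: "'a mpoly"
  proof
    assume f: "keys f \<subseteq> ?D"
    have "(\<lambda>x. \<Sum>d\<in>keys f. lookup f d * mon d x) \<in> V"
      using f by (intro sum scale) auto
    also have "(\<lambda>x. \<Sum>d\<in>keys f. lookup f d * mon d x) = mpoly_eval f"
      by (auto simp: mpoly_eval_superset[of "keys f"])
    finally have "mpoly_eval f \<in> V" .
    then show "keys f \<subseteq> R \<and> mpoly_eval f \<in> V"
      using f by auto
  qed (use monomial_mem[OF I] in blast)
  have C': "C = (\<lambda>f. restrict (mpoly_eval f) X) ` Poly_span ?D"
    unfolding C by (auto simp: Poly_span_iff span)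
  show ?thesis
  proof (rule the_equality)
    show "?D \<subseteq> R \<and> C = (\<lambda>f. restrict (mpoly_eval f) X) ` Poly_span ?D"
      using C' by auto
  next
    fix D assume D: "D \<subseteq> R \<and> C = (\<lambda>f. restrict (mpoly_eval f) X) ` Poly_span D"
    show "D = ?D"
    proof (rule antisym)
      show "D \<subseteq> ?D"
        using D C' by (intro Poly_span_inj[of R X D ?D]) (auto intro: inj)
      show "?D \<subseteq> D"
        using D C' by (intro Poly_span_inj[of R X ?D D]) (auto intro: inj)
    qed
  qed
qed


subsection \<open>Binary forms and restrictions to lines\<close>

text \<open>Forms are functions on the whole plane rather than on the standard representatives, so
  that arbitrary linear substitutions make sense.\<close>

definition binary_forms :: "nat \<Rightarrow> ('a::comm_ring_1 \<Rightarrow> 'a \<Rightarrow> 'a) set" where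
  "binary_forms k = {h. \<exists>c. \<forall>s t. h s t = (\<Sum>j\<le>k. c j * s ^ (k - j) * t ^ j)}"

text \<open>Unlike the columns of an embedding, \<open>a\<close> and \<open>b\<close> may be
  linearly dependent and have any support.\<close>

definition proj_forms :: "nat \<Rightarrow> ((nat \<Rightarrow> 'a::comm_ring_1) \<Rightarrow> 'a) set" where
  "proj_forms k = {F. \<forall>a b. (\<lambda>s t. F (\<lambda>i. s * a i + t * b i)) \<in> binary_forms k}"

text \<open>The direction \<open>b\<close> may be zero, and neither \<open>a\<close> nor
  \<open>b\<close> is restricted in its support.\<close>

definition aff_polys :: "nat \<Rightarrow> ((nat \<Rightarrow> 'a::comm_ring_1) \<Rightarrow> 'a) set" where
  "aff_polys k = {F. \<forall>a b. \<exists>g. degree g \<le> k \<and> (\<forall>t. F (\<lambda>i. a i + t * b i) = poly g t)}"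

lemma binary_forms_zero: "(\<lambda>s t. 0) \<in> binary_forms k"
  by (auto simp: binary_forms_def intro: exI[of _ "\<lambda>_. 0"])

lemma binary_forms_add:
  assumes "h \<in> binary_forms k" "h' \<in> binary_forms k"
  shows "(\<lambda>s t. h s t + h' s t) \<in> binary_forms k"
proof -
  obtain c c' where "\<And>s t. h s t = (\<Sum>j\<le>k. c j * s ^ (k - j) * t ^ j)"
      "\<And>s t. h' s t = (\<Sum>j\<le>k. c' j * s ^ (k - j) * t ^ j)"
    using assms unfolding binary_forms_def by blast
  then have "\<forall>s t. h s t + h' s t = (\<Sum>j\<le>k. (c j + c' j) * s ^ (k - j) * t ^ j)"
    by (simp add: sum.distrib distrib_right)
  then show ?thesis
    unfolding binary_forms_def by (intro CollectI exI[of _ "\<lambda>j. c j + c' j"])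
qed

lemma binary_forms_scale:
  assumes "h \<in> binary_forms k"
  shows "(\<lambda>s t. \<alpha> * h s t) \<in> binary_forms k"
proof -
  obtain c where "\<And>s t. h s t = (\<Sum>j\<le>k. c j * s ^ (k - j) * t ^ j)"
    using assms unfolding binary_forms_def by blast
  then have "\<forall>s t. \<alpha> * h s t = (\<Sum>j\<le>k. (\<alpha> * c j) * s ^ (k - j) * t ^ j)"
    by (simp add: sum_distrib_left mult.assoc)
  then show ?thesis
    unfolding binary_forms_def by (intro CollectI exI[of _ "\<lambda>j. \<alpha> * c j"])
qed

lemma binary_forms_sum:
  "(\<And>j. j \<in> A \<Longrightarrow> h j \<in> binary_forms k) \<Longrightarrow> (\<lambda>s t. \<Sum>j\<in>A. h j s t) \<in> binary_forms k"
  by (induction A rule: infinite_finite_induct) (auto intro: binary_forms_zero binary_forms_add)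

lemma binary_forms_mult_fst:
  assumes "h \<in> binary_forms k"
  shows "(\<lambda>s t. s * h s t) \<in> binary_forms (Suc k)"
proof -
  obtain c where c: "\<And>s t. h s t = (\<Sum>j\<le>k. c j * s ^ (k - j) * t ^ j)"
    using assms unfolding binary_forms_def by blast
  have "s * h s t = (\<Sum>j\<le>Suc k. (if j \<le> k then c j else 0) * s ^ (Suc k - j) * t ^ j)" for s t
    by (simp add: c sum_distrib_left Suc_diff_le mult_ac)
  then show ?thesis
    unfolding binary_forms_def by (intro CollectI exI[of _ "\<lambda>j. if j \<le> k then c j else 0"]) blast
qed

lemma binary_forms_mult_snd:
  assumes "h \<in> binary_forms k"
  shows "(\<lambda>s t. t * h s t) \<in> binary_forms (Suc k)"
proof -
  obtain c where c: "\<And>s t. h s t = (\<Sum>j\<le>k. c j * s ^ (k - j) * t ^ j)"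
    using assms unfolding binary_forms_def by blast
  have "t * h s t = (\<Sum>j\<le>Suc k. (case j of 0 \<Rightarrow> 0 | Suc i \<Rightarrow> c i) * s ^ (Suc k - j) * t ^ j)" for s t
    by (simp add: c sum_distrib_left sum.atMost_Suc_shift mult_ac del: sum.atMost_Suc)
  then show ?thesis
    unfolding binary_forms_def by blast
qed

lemma binary_forms_mult_linear:
  assumes "h \<in> binary_forms k"
  shows "(\<lambda>s t. (s * \<alpha> + t * \<beta>) * h s t) \<in> binary_forms (Suc k)"
proof -
  have "(\<lambda>s t. \<alpha> * (s * h s t) + \<beta> * (t * h s t)) \<in> binary_forms (Suc k)"
    using assms
    by (intro binary_forms_add binary_forms_scale binary_forms_mult_fst binary_forms_mult_snd)
  then show ?thesis
    by (simp add: algebra_simps)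
qed

lemma binary_forms_linear_powers:
  "(\<lambda>s t. (s * \<alpha> + t * \<beta>) ^ m * (s * \<gamma> + t * \<delta>) ^ n) \<in> binary_forms (m + n)"
proof (induction m)
  case 0
  show ?case
  proof (induction n)
    case 0
    show ?case
      by (auto simp: binary_forms_def intro: exI[of _ "\<lambda>_. 1"])
  next
    case (Suc n)
    from binary_forms_mult_linear[OF this, of \<gamma> \<delta>] show ?case
      by simp
  qed
next
  case (Suc m)
  from binary_forms_mult_linear[OF this, of \<alpha> \<beta>] show ?case
    by (simp add: mult_ac)
qed

text \<open>Each term becomes a product of \<open>k\<close> linear forms. This permits changing the
  pair of vectors spanning a plane to one adapted to a chart.\<close>

lemma binary_forms_linear_subst:
  assumes "h \<in> binary_forms k"
  shows "(\<lambda>s t. h (s * \<alpha> + t * \<beta>) (s * \<gamma> + t * \<delta>)) \<in> binary_forms k"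
proof -
  obtain c where c: "\<And>s t. h s t = (\<Sum>j\<le>k. c j * s ^ (k - j) * t ^ j)"
    using assms unfolding binary_forms_def by blast
  have "(\<lambda>s t. (s * \<alpha> + t * \<beta>) ^ (k - j) * (s * \<gamma> + t * \<delta>) ^ j) \<in> binary_forms k" if "j \<le> k" for j
    using binary_forms_linear_powers[of \<alpha> \<beta> "k - j" \<gamma> \<delta> j] that by simp
  then show ?thesis
    by (auto simp: c mult.assoc intro!: binary_forms_sum binary_forms_scale)
qed

lemma binary_forms_homogeneous:
  assumes "h \<in> binary_forms k"
  shows "h (r * s) (r * t) = r ^ k * h s t"
proof -
  obtain c where c: "\<And>s t. h s t = (\<Sum>j\<le>k. c j * s ^ (k - j) * t ^ j)"
    using assms unfolding binary_forms_def by blast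
  have "c j * (r * s) ^ (k - j) * (r * t) ^ j = r ^ k * (c j * s ^ (k - j) * t ^ j)" if "j \<le> k" for j
  proof -
    have "r ^ k = r ^ (k - j) * r ^ j"
      using that by (simp flip: power_add)
    then show ?thesis
      by (simp add: power_mult_distrib mult_ac)
  qed
  then show ?thesis
    by (simp add: c sum_distrib_left)
qed

section \<open>Closure of the two function spaces under diagonal scalings\<close>

lemma scaling_closed_proj_forms:
  "scaling_closed (proj_forms k :: ((nat \<Rightarrow> 'a::{field,finite}) \<Rightarrow> 'a) set)"
proof
  fix F :: "(nat \<Rightarrow> 'a) \<Rightarrow> 'a" and u
  assume F: "F \<in> proj_forms k"
  have "(\<lambda>s t. F (\<lambda>i. s * (u i * a i) + t * (u i * b i))) \<in> binary_forms k" for a b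
    using F by (simp add: proj_forms_def)
  then show "(\<lambda>x. F (\<lambda>i. u i * x i)) \<in> proj_forms k"
    by (simp add: proj_forms_def algebra_simps)
qed (auto simp: proj_forms_def binary_forms_zero binary_forms_add binary_forms_scale)

lemma scaling_closed_aff_polys:
  "scaling_closed (aff_polys k :: ((nat \<Rightarrow> 'a::{field,finite}) \<Rightarrow> 'a) set)"
proof
  show "(\<lambda>x. 0) \<in> (aff_polys k :: ((nat \<Rightarrow> 'a) \<Rightarrow> 'a) set)"
    by (auto simp: aff_polys_def intro!: exI[of _ 0])
next
  fix F G :: "(nat \<Rightarrow> 'a) \<Rightarrow> 'a"
  assume FG: "F \<in> aff_polys k" "G \<in> aff_polys k"
  show "(\<lambda>x. F x + G x) \<in> aff_polys k"
    unfolding aff_polys_def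
  proof (intro CollectI allI)
    fix a b
    obtain f g where "degree f \<le> k" "\<And>t. F (\<lambda>i. a i + t * b i) = poly f t"
        "degree g \<le> k" "\<And>t. G (\<lambda>i. a i + t * b i) = poly g t"
      using FG unfolding aff_polys_def by blast
    then show "\<exists>h. degree h \<le> k \<and> (\<forall>t. F (\<lambda>i. a i + t * b i) + G (\<lambda>i. a i + t * b i) = poly h t)"
      by (intro exI[of _ "f + g"]) (auto intro: degree_add_le)
  qed
next
  fix F :: "(nat \<Rightarrow> 'a) \<Rightarrow> 'a" and c
  assume F: "F \<in> aff_polys k"
  show "(\<lambda>x. c * F x) \<in> aff_polys k"
    unfolding aff_polys_def
  proof (intro CollectI allI)
    fix a b
    obtain f where "degree f \<le> k" "\<And>t. F (\<lambda>i. a i + t * b i) = poly f t"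
      using F unfolding aff_polys_def by blast
    then show "\<exists>h. degree h \<le> k \<and> (\<forall>t. c * F (\<lambda>i. a i + t * b i) = poly h t)"
      by (intro exI[of _ "smult c f"]) (auto intro: order_trans[OF degree_smult_le])
  qed
next
  fix F :: "(nat \<Rightarrow> 'a) \<Rightarrow> 'a" and u
  assume F: "F \<in> aff_polys k"
  have "\<exists>g. degree g \<le> k \<and> (\<forall>t. F (\<lambda>i. u i * a i + t * (u i * b i)) = poly g t)" for a b
    using F by (simp add: aff_polys_def)
  then show "(\<lambda>x. F (\<lambda>i. u i * x i)) \<in> aff_polys k"
    by (simp add: aff_polys_def algebra_simps)
qed

section \<open>Degrees of monomials in the two spaces, and the passage between the spaces\<close>

lemma mon_scaleI: "mon d (\<lambda>i. c * x i) = c ^ total_degree d * mon d x"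
  by (simp add: mon_mult mon_const)

text \<open>Along the all-one vector the monomial is a power with exponent its total degree, while a
  form of degree \<open>k\<close> scales there by the \<open>k\<close>-th power.\<close>

lemma exp_reduce_total_degree_proj_form:
  assumes "mon e \<in> (proj_forms k :: ((nat \<Rightarrow> 'a::{field,finite}) \<Rightarrow> 'a) set)"
  shows "exp_reduce CARD('a) (total_degree e) = exp_reduce CARD('a) k"
proof (rule power_eq_imp_exp_reduce_eq)
  fix x :: 'a
  let ?h = "\<lambda>s t :: 'a. mon e (\<lambda>i. s * 1 + t * 0)"
  have "?h \<in> binary_forms k"
    using assms by (simp add: proj_forms_def del: mult_1_right mult_zero_right)
  from binary_forms_homogeneous[OF this, of x 1 0]
  show "x ^ total_degree e = x ^ k"
    by (simp add: mon_const)
qed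

text \<open>On the diagonal line through the origin the monomial is a pure power of
  \<open>t\<close>, so the representative of its total degree is at most \<open>k\<close>. A larger
  total degree would have a representative above \<open>k\<close>.\<close>

lemma total_degree_le_aff_poly:
  assumes "mon e \<in> (aff_polys k :: ((nat \<Rightarrow> 'a::{field,finite}) \<Rightarrow> 'a) set)"
    and "k \<le> CARD('a) - 2" "finite I" "e \<in> tuples I" "reduced CARD('a) e" "I \<noteq> {}"
  shows "total_degree e \<le> k + (card I - 1) * (CARD('a) - 1)"
proof (rule ccontr)
  let ?q = "CARD('a)"
  let ?N = "total_degree e"
  assume contra: "\<not> ?thesis"
  obtain g :: "'a poly" where g: "degree g \<le> k" "\<And>t. mon e (\<lambda>i. t) = poly g t"
    using assms(1)[unfolded aff_polys_def mem_Collect_eq, rule_format, of "\<lambda>_. 0" "\<lambda>_. 1"] by auto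
  have "monom 1 (exp_reduce ?q ?N) = g"
  proof (rule degree_less_card_eqI)
    show "degree (monom (1::'a) (exp_reduce ?q ?N)) \<le> ?q - 1"
      using exp_reduce_le_card[OF card_field_ge_2[where 'a='a], of ?N]
      by (simp add: degree_monom_eq)
    show "degree g \<le> ?q - 1"
      using g(1) assms(2) by linarith
    show "poly (monom 1 (exp_reduce ?q ?N)) x = poly g x" for x
      by (simp add: poly_monom power_exp_reduce mon_const flip: g(2))
  qed
  then have le: "exp_reduce ?q ?N \<le> k"
    using g(1) degree_monom_eq[of "1::'a" "exp_reduce ?q ?N"] by simp
  have "?N = (\<Sum>i\<in>I. lookup e i)"
    using assms by (intro total_degree_superset) (auto simp: tuples_def)
  also have "\<dots> \<le> card I * (?q - 1)"
    using assms(5) sum_bounded_above[of I "lookup e" "?q - 1"] by (simp add: reduced_def)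
  also have "\<dots> = (card I - 1) * (?q - 1) + (?q - 1)"
    using assms(3,6) by (cases "card I") auto
  finally have N: "?N \<le> (card I - 1) * (?q - 1) + (?q - 1)" .
  \<comment> \<open>Reducedness bounds \<open>r\<close> by \<open>q - 1\<close> and the assumed
    violation gives \<open>r > k\<close>; so \<open>r\<close> is its own representative, and also
    that of the total degree.\<close>
  define r where "r = ?N - (card I - 1) * (?q - 1)"
  have r: "r > k" "r \<le> ?q - 1" "?N = r + (card I - 1) * (?q - 1)"
    using contra N by (auto simp: r_def)
  have "exp_reduce ?q ?N = r"
    unfolding r(3) using exp_reduce_add_mult[of r ?q] exp_reduce_id[OF r(2)] r(1) by simp
  with le r(1) show False
    by simp
qed

text \<open>
  On the chart \<open>x\<^sub>0 = 1\<close> a form divisible by \<open>x\<^sub>0\<close> restricts to a line as \<open>h(1, T)\<close>, where \<open>h\<close>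
  vanishes at the point \<open>(0 : 1)\<close>. This drops the degree from \<open>k\<close> to \<open>k - 1\<close>.
\<close>

lemma aff_poly_dehomogenize:
  fixes k :: nat
  assumes "mon (Poly_Mapping.single 0 n + e) \<in> (proj_forms k :: ((nat \<Rightarrow> 'a::{field,finite}) \<Rightarrow> 'a) set)"
    and "n > 0" "lookup e 0 = 0" "k \<ge> 1"
  shows "mon e \<in> (aff_polys (k - 1) :: ((nat \<Rightarrow> 'a) \<Rightarrow> 'a) set)"
  unfolding aff_polys_def
proof (intro CollectI allI)
  fix a b :: "nat \<Rightarrow> 'a"
  let ?d = "Poly_Mapping.single 0 n + e"
  \<comment> \<open>Overwriting the coordinates of index 0 by 1 and 0 moves the line into the chart;
    \<open>e\<close> does not involve that variable.\<close>
  define h where "h s t = mon ?d (\<lambda>i. s * (a(0 := 1)) i + t * (b(0 := 0)) i)" for s t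
  have "h \<in> binary_forms k"
    using assms(1) unfolding h_def proj_forms_def by blast
  then obtain c where c: "\<And>s t. h s t = (\<Sum>j\<le>k. c j * s ^ (k - j) * t ^ j)"
    unfolding binary_forms_def by blast
  have e0: "i \<noteq> 0" if "i \<in> keys e" for i
    using that assms(3) by (metis in_keys_iff)
  \<comment> \<open>At \<open>(0, 1)\<close> only the leading term in \<open>t\<close> survives,
    while the factor with positive exponent \<open>n\<close> makes the monomial vanish.\<close>
  have "c k = h 0 1"
  proof -
    have "h 0 1 = (\<Sum>j\<le>k. if j = k then c j else 0)"
      unfolding c by (intro sum.cong) (auto simp: power_0_left)
    then show ?thesis
      by simp
  qed
  also have "h 0 1 = 0"
    using assms(2) by (simp add: h_def mon_add power_0_left)
  finally have ck: "c k = 0" .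
  define g where "g = (\<Sum>j\<le>k - 1. monom (c j) j)"
  have "mon e (\<lambda>i. a i + t * b i) = poly g t" for t
  proof -
    have "mon e (\<lambda>i. a i + t * b i) = h 1 t"
      unfolding h_def mon_add by (auto intro!: mon_cong dest: e0)
    also have "\<dots> = (\<Sum>j\<le>Suc (k - 1). c j * t ^ j)"
      using assms(4) by (simp add: c del: sum.atMost_Suc)
    also have "\<dots> = poly g t"
      unfolding sum.atMost_Suc using assms(4) ck by (simp add: g_def poly_sum poly_monom)
    finally show ?thesis .
  qed
  moreover have "degree g \<le> k - 1"
    unfolding g_def by (intro degree_sum_le) (auto intro: order_trans[OF degree_monom_le])
  ultimately show "\<exists>g. degree g \<le> k - 1 \<and> (\<forall>t. mon e (\<lambda>i. a i + t * b i) = poly g t)"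
    by blast
qed

text \<open>Converse of dehomogenization. The degree congruence makes the monomial homogeneous of
  degree \<open>k\<close> as a function, so on a pair in the chart it is the homogenization of a
  polynomial in \<open>t\<close>; the remaining pairs reduce to this case by linear
  substitution.\<close>

lemma proj_form_homogenize:
  fixes k :: nat
  assumes "mon e \<in> (aff_polys (k - 1) :: ((nat \<Rightarrow> 'a::{field,finite}) \<Rightarrow> 'a) set)"
    and "n > 0" "lookup e 0 = 0" "k \<ge> 1"
    and "exp_reduce CARD('a) (n + total_degree e) = exp_reduce CARD('a) k"
  shows "mon (Poly_Mapping.single 0 n + e) \<in> (proj_forms k :: ((nat \<Rightarrow> 'a) \<Rightarrow> 'a) set)"
proof -
  let ?d = "Poly_Mapping.single 0 n + e"
  have hom: "mon ?d (\<lambda>i. r * x i) = r ^ k * mon ?d x" for r :: 'a and x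
  proof -
    have "r ^ (n + total_degree e) = r ^ k"
      by (metis assms(5) power_exp_reduce)
    then show ?thesis
      by (simp add: mon_scaleI total_degree_add)
  qed
  have chart: "(\<lambda>u t. mon ?d (\<lambda>i. u * c i + t * d i)) \<in> binary_forms k"
    if cd: "c 0 = 1" "d 0 = 0" for c d :: "nat \<Rightarrow> 'a"
  proof -
    obtain g where g: "degree g \<le> k - 1" "\<And>t. mon e (\<lambda>i. c i + t * d i) = poly g t"
      using assms(1) unfolding aff_polys_def by blast
    have "mon ?d (\<lambda>i. u * c i + t * d i) = (\<Sum>j\<le>k. coeff g j * u ^ (k - j) * t ^ j)" for u t
    proof (cases "u = 0")
      case True
      \<comment> \<open>At \<open>u = 0\<close> only the term \<open>j = k\<close> could survive.
        The bound \<open>k - 1\<close> kills it, matching the zero of the monomial there.\<close>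
      have "coeff g k = 0"
        using g(1) assms(4) by (intro coeff_eq_0) auto
      then have "(\<Sum>j\<le>k. coeff g j * 0 ^ (k - j) * t ^ j) = 0"
        by (intro sum.neutral) (auto simp: power_0_left)
      then show ?thesis
        using True cd assms(2) by (simp add: mon_add power_0_left)
    next
      case False
      have "mon ?d (\<lambda>i. u * c i + t * d i) = mon ?d (\<lambda>i. u * (c i + t / u * d i))"
        using False by (simp add: distrib_left mult.assoc[symmetric])
      also have "\<dots> = u ^ k * poly g (t / u)"
        unfolding hom using cd by (simp add: mon_add g(2) del: times_divide_eq_left)
      also have "poly g (t / u) = (\<Sum>j\<le>k. coeff g j * (t / u) ^ j)"
        unfolding poly_altdef using g(1)
        by (intro sum.mono_neutral_left) (auto simp: not_le intro: coeff_eq_0)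
      also have "u ^ k * \<dots> = (\<Sum>j\<le>k. coeff g j * u ^ (k - j) * t ^ j)"
        unfolding sum_distrib_left
      proof (intro sum.cong refl)
        fix j assume "j \<in> {..k}"
        then have "u ^ k = u ^ (k - j) * u ^ j"
          by (simp flip: power_add)
        then show "u ^ k * (coeff g j * (t / u) ^ j) = coeff g j * u ^ (k - j) * t ^ j"
          using False by (simp add: power_divide)
      qed
      finally show ?thesis .
    qed
    then show ?thesis
      unfolding binary_forms_def by blast
  qed
  show ?thesis
    unfolding proj_forms_def
  proof (intro CollectI allI)
    fix a b :: "nat \<Rightarrow> 'a"
    consider "a 0 = 0" "b 0 = 0" | "a 0 \<noteq> 0" | "b 0 \<noteq> 0"
      by blast
    then show "(\<lambda>s t. mon ?d (\<lambda>i. s * a i + t * b i)) \<in> binary_forms k"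
    proof cases
      case 1
      then show ?thesis
        using assms(2) by (simp add: mon_add power_0_left binary_forms_zero)
    next
      case 2
      \<comment> \<open>With \<open>c = a / a 0\<close> and \<open>d = b - (b 0 / a 0) * a\<close>,
        which lie in the chart, \<open>s * a + t * b\<close> equals
        \<open>(s * a 0 + t * b 0) * c + t * d\<close>.\<close>
      have "(\<lambda>s t. mon ?d (\<lambda>i. (s * a 0 + t * b 0) * (a i / a 0) +
          (s * 0 + t * 1) * (b i - b 0 / a 0 * a i))) \<in> binary_forms k"
        using 2 by (intro binary_forms_linear_subst[OF chart]) auto
      also have "(\<lambda>s t. mon ?d (\<lambda>i. (s * a 0 + t * b 0) * (a i / a 0) +
          (s * 0 + t * 1) * (b i - b 0 / a 0 * a i))) =
          (\<lambda>s t. mon ?d (\<lambda>i. s * a i + t * b i))"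
        using 2 by (intro ext arg_cong[of _ _ "mon ?d"]) (simp add: field_simps)
      finally show ?thesis .
    next
      case 3
      have "(\<lambda>s t. mon ?d (\<lambda>i. (s * a 0 + t * b 0) * (b i / b 0) +
          (s * 1 + t * 0) * (a i - a 0 / b 0 * b i))) \<in> binary_forms k"
        using 3 by (intro binary_forms_linear_subst[OF chart]) auto
      also have "(\<lambda>s t. mon ?d (\<lambda>i. (s * a 0 + t * b 0) * (b i / b 0) +
          (s * 1 + t * 0) * (a i - a 0 / b 0 * b i))) =
          (\<lambda>s t. mon ?d (\<lambda>i. s * a i + t * b i))"
        using 3 by (intro ext arg_cong[of _ _ "mon ?d"]) (simp add: field_simps)
      finally show ?thesis .
    qed
  qed
qed


subsection \<open>The codes in terms of functions\<close>

lemma mpoly_eval_cong: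
  assumes "keys f \<subseteq> tuples I" "\<And>i. i \<in> I \<Longrightarrow> x i = y i"
  shows "mpoly_eval f x = mpoly_eval f y"
proof -
  have "mon d x = mon d y" if "d \<in> keys f" for d
    using that assms by (intro mon_cong) (auto simp: tuples_def)
  then show ?thesis
    by (simp add: mpoly_eval_superset[of "keys f"])
qed

lemma mem_simplex_iff: "d \<in> simplex m v \<longleftrightarrow> d \<in> tuples {..m} \<and> total_degree d = v"
  by (auto simp: simplex_def tuples_def total_degree_superset[of "{..m}"])

lemma mpoly_eval_homogeneous:
  assumes "f \<in> hom_polys m v"
  shows "mpoly_eval f (\<lambda>i. c * x i) = c ^ v * mpoly_eval f x"
proof -
  have "total_degree d = v" if "d \<in> keys f" for d
    using that assms by (auto simp: hom_polys_def mem_simplex_iff)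
  then show ?thesis
    by (auto simp: mpoly_eval_superset[of "keys f"] mon_scaleI sum_distrib_left mult_ac
        intro!: sum.cong)
qed

lemma hom_polys_subset_tuples: "f \<in> hom_polys m v \<Longrightarrow> keys f \<subseteq> tuples {..m}"
  by (auto simp: hom_polys_def mem_simplex_iff)

section \<open>Restriction of polynomials to lines\<close>

lemma mpoly_eval_comp_P:
  "mpoly_eval (comp_P f L) x = mpoly_eval f (\<lambda>i. x 0 * L (1, 0) i + x 1 * L (0, 1) i)"
proof -
  have "mpoly_eval (Const (L (1, 0) i) * Var 0 + Const (L (0, 1) i) * Var 1) x =
      x 0 * L (1, 0) i + x 1 * L (0, 1) i" for i
    by (simp add: mpoly_eval_add mpoly_eval_mult mult.commute)
  then show ?thesis
    unfolding comp_P_def substitute_def mpoly_eval_superset[OF finite_keys order_refl, of f]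
      mpoly_eval_sum mpoly_eval_mult mpoly_eval_prod mpoly_eval_power mpoly_eval_single
    by (simp only: mon_0 mult_1_right) (simp only: mon_def)
qed

lemma poly_comp_A: "poly (comp_A f L) t = mpoly_eval f (\<lambda>i. L (1, 0) i + t * L (0, 1) i)"
  unfolding comp_A_def substitute_def
  by (simp add: poly_sum poly_prod mpoly_eval_superset[of "keys f" f] mon_def)

lemma tuple_binary:
  assumes "d \<in> simplex 1 k"
  obtains j where "j \<le> k" "d = Poly_Mapping.single 0 (k - j) + Poly_Mapping.single 1 j"
proof
  have sum: "lookup d 0 + lookup d 1 = k" and keys: "keys d \<subseteq> {..1}"
    using assms by (auto simp: simplex_def tuples_def)
  show "lookup d 1 \<le> k"
    using sum by simp
  show "d = Poly_Mapping.single 0 (k - lookup d 1) + Poly_Mapping.single 1 (lookup d 1)"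
  proof (rule poly_mapping_eqI)
    fix i
    show "lookup d i = lookup (Poly_Mapping.single 0 (k - lookup d 1)
        + Poly_Mapping.single 1 (lookup d 1)) i"
    proof (cases "i \<le> 1")
      case True
      then have "i = 0 \<or> i = 1"
        by auto
      then show ?thesis
        using sum by (auto simp: lookup_add lookup_single)
    next
      case False
      then have "i \<notin> keys d"
        using keys by auto
      then show ?thesis
        using False by (auto simp: lookup_add lookup_single in_keys_iff)
    qed
  qed
qed

lemma mem_PRS_iff:
  "F \<in> PRS k \<longleftrightarrow> (\<exists>h \<in> binary_forms k. F = restrict (\<lambda>x. h (x 0) (x 1)) (proj_points 1))"
proof
  let ?d = "\<lambda>j. Poly_Mapping.single 0 (k - j) + Poly_Mapping.single 1 j :: exponents"
  assume "F \<in> PRS k"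
  then obtain f where f: "f \<in> hom_polys 1 k" "F = ev_P 1 f"
    by (auto simp: PRS_def)
  have form: "(\<lambda>s t. lookup f d * mon d (\<lambda>i. if i = 0 then s else t)) \<in> binary_forms k"
    if d: "d \<in> keys f" for d
  proof -
    from d f(1) have "d \<in> simplex 1 k"
      by (auto simp: hom_polys_def)
    then obtain j where j: "j \<le> k" "d = ?d j"
      using tuple_binary by blast
    show ?thesis
      using binary_forms_linear_powers[of 1 0 "k - j" 0 1 j] j
      by (intro binary_forms_scale) (simp add: mon_add)
  qed
  define h where "h s t = mpoly_eval f (\<lambda>i. if i = 0 then s else t)" for s t
  have "h \<in> binary_forms k"
    unfolding h_def mpoly_eval_superset[OF finite_keys order_refl]
    by (intro binary_forms_sum form)
  moreover have "mpoly_eval f x = h (x 0) (x 1)" for x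
    unfolding h_def using hom_polys_subset_tuples[OF f(1)]
    by (intro mpoly_eval_cong[of _ "{..1}"]) (auto simp: le_Suc_eq)
  ultimately show "\<exists>h \<in> binary_forms k. F = restrict (\<lambda>x. h (x 0) (x 1)) (proj_points 1)"
    using f(2) by (auto simp: ev_P_def intro!: bexI[of _ h])
next
  assume "\<exists>h \<in> binary_forms k. F = restrict (\<lambda>x. h (x 0) (x 1)) (proj_points 1)"
  then obtain h c where F: "F = restrict (\<lambda>x. h (x 0) (x 1)) (proj_points 1)"
    and c: "\<And>s t. h s t = (\<Sum>j\<le>k. c j * s ^ (k - j) * t ^ j)"
    unfolding binary_forms_def by blast
  let ?d = "\<lambda>j. Poly_Mapping.single 0 (k - j) + Poly_Mapping.single 1 j :: exponents"
  let ?f = "\<Sum>j\<le>k. Poly_Mapping.single (?d j) (c j)"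
  have "keys (?d j) \<subseteq> {..1}" for j
    by (rule order_trans[OF Poly_Mapping.keys_add]) simp
  then have "?d j \<in> simplex 1 k" if "j \<le> k" for j
    using that by (simp add: mem_simplex_iff total_degree_add tuples_def del: One_nat_def)
  then have "?f \<in> hom_polys 1 k"
    using keys_sum_single[of ?d c "{..k}"] by (auto simp: hom_polys_def)
  moreover have "F = ev_P 1 ?f"
    by (auto simp: F ev_P_def mpoly_eval_sum mon_add c mult.assoc fun_eq_iff restrict_def)
  ultimately show "F \<in> PRS k"
    by (auto simp: PRS_def)
qed

lemma linear_map_lincomb: "linear_map (\<lambda>p i. fst p * a i + snd p * b i)"
  unfolding linear_map_def Vector_Spaces.linear_iff
  by (auto simp: vector_space_def fun_eq_iff algebra_simps)

text \<open>Embeddings give only independent pairs, and codewords see only standard representatives.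
  Both gaps are closed by homogeneity: since \<open>v\<close> and \<open>k\<close> are positive and
  congruent modulo \<open>q - 1\<close>, the function scales by \<open>k\<close>-th powers.\<close>

lemma proj_form_iff_lines:
  fixes f :: "'a::{field,finite} mpoly"
  assumes f: "f \<in> hom_polys m v" and "v > 0" "k > 0" "v mod (CARD('a) - 1) = k mod (CARD('a) - 1)"
  shows "(\<forall>L \<in> Emb_P m. ev_P 1 (comp_P f L) \<in> PRS k) \<longleftrightarrow> mpoly_eval f \<in> proj_forms k"
proof
  assume "mpoly_eval f \<in> proj_forms k"
  then have form: "(\<lambda>s t. mpoly_eval f (\<lambda>i. s * a i + t * b i)) \<in> binary_forms k" for a b
    by (simp add: proj_forms_def)
  show "\<forall>L \<in> Emb_P m. ev_P 1 (comp_P f L) \<in> PRS k"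
  proof
    fix L
    show "ev_P 1 (comp_P f L) \<in> PRS k"
      unfolding mem_PRS_iff using form[of "L (1, 0)" "L (0, 1)"]
      by (rule bexI[rotated]) (simp add: ev_P_def mpoly_eval_comp_P[abs_def])
  qed
next
  assume lines: "\<forall>L \<in> Emb_P m. ev_P 1 (comp_P f L) \<in> PRS k"
  let ?F = "mpoly_eval f"
  have hom: "?F (\<lambda>i. c * x i) = c ^ k * ?F x" for c x
  proof -
    have "c ^ v = c ^ k"
      using assms by (metis exp_reduce_cong power_exp_reduce)
    then show ?thesis
      using mpoly_eval_homogeneous[OF f] by simp
  qed
  \<comment> \<open>On multiples of a single vector the function is a constant times the
    \<open>k\<close>-th power of a linear form.\<close>
  have collinear: "(\<lambda>s t. ?F (\<lambda>i. (s * \<alpha> + t * \<beta>) * x i)) \<in> binary_forms k" for \<alpha> \<beta> x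
    using binary_forms_scale[OF binary_forms_linear_powers[of \<alpha> \<beta> k 0 0 0], of "?F x"]
    unfolding hom by (simp add: mult.commute)
  show "?F \<in> proj_forms k"
    unfolding proj_forms_def
  proof (intro CollectI allI)
    fix a b :: "nat \<Rightarrow> 'a"
    \<comment> \<open>Truncation puts the vectors into the range required of an embedding without
      changing the values of \<open>f\<close>.\<close>
    define a' where "a' i = (if i \<le> m then a i else 0)" for i
    define b' where "b' i = (if i \<le> m then b i else 0)" for i
    have "?F (\<lambda>i. s * a i + t * b i) = ?F (\<lambda>i. s * a' i + t * b' i)" for s t
      using hom_polys_subset_tuples[OF f]
      by (rule mpoly_eval_cong) (auto simp: a'_def b'_def)
    moreover have "(\<lambda>s t. ?F (\<lambda>i. s * a' i + t * b' i)) \<in> binary_forms k"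
    proof -
      consider "a' = (\<lambda>_. 0)" | r where "b' = (\<lambda>i. r * a' i)"
        | "a' \<noteq> (\<lambda>_. 0)" "\<nexists>r. b' = (\<lambda>i. r * a' i)"
        by blast
      then show ?thesis
      proof cases
        case 1
        then show ?thesis
          using collinear[of 0 1 b'] by simp
      next
        case 2
        then show ?thesis
          using collinear[of 1 r a'] by (simp add: algebra_simps)
      next
        case 3
        define L where "L p = (\<lambda>i. fst p * a' i + snd p * b' i)" for p
        have "inj L"
        proof (rule injI)
          fix p p' assume "L p = L p'"
          then have eq: "fst p * a' i + snd p * b' i = fst p' * a' i + snd p' * b' i" for i
            by (auto simp: L_def fun_eq_iff)
          have snd: "snd p = snd p'"
          proof (rule ccontr)
            assume "snd p \<noteq> snd p'"
            then have "b' i = ((fst p' - fst p) / (snd p - snd p')) * a' i" for i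
              using eq[of i] by (simp add: field_simps)
            then show False
              using 3(2) by blast
          qed
          obtain i where "a' i \<noteq> 0"
            using 3(1) by blast
          then have "fst p = fst p'"
            using eq[of i] snd by simp
          with snd show "p = p'"
            by (simp add: prod_eq_iff)
        qed
        then have "L \<in> Emb_P m"
          using linear_map_lincomb[of a' b']
          by (auto simp: Emb_P_def L_def[abs_def] vectors_def a'_def b'_def)
        then obtain h where h: "h \<in> binary_forms k"
            "ev_P 1 (comp_P f L) = restrict (\<lambda>x. h (x 0) (x 1)) (proj_points 1)"
          using lines mem_PRS_iff by blast
        have pt: "?F (\<lambda>i. x 0 * a' i + x 1 * b' i) = h (x 0) (x 1)" if "x \<in> proj_points 1" for x
          using fun_cong[OF h(2), of x] that by (simp add: ev_P_def mpoly_eval_comp_P L_def)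
        \<comment> \<open>Every \<open>(s, t)\<close> is a multiple of the standard representative
          \<open>(0, 1)\<close> or \<open>(1, t / s)\<close>, and both sides scale by
          \<open>k\<close>-th powers.\<close>
        have "?F (\<lambda>i. s * a' i + t * b' i) = h s t" for s t
        proof (cases "s = 0")
          case True
          have "(\<lambda>i. if i = 1 then 1 else 0) \<in> (proj_points 1 :: (nat \<Rightarrow> 'a) set)"
            by (auto simp: proj_points_def vectors_def intro!: exI[of _ 1])
          from pt[OF this] have "?F b' = h 0 1"
            by simp
          then show ?thesis
            using True hom[of t b'] binary_forms_homogeneous[OF h(1), of t 0 1] by simp
        next
          case False
          have "(\<lambda>i. if i = 0 then 1 else if i = 1 then t / s else 0) \<in> (proj_points 1 :: (nat \<Rightarrow> 'a) set)"
            by (auto simp: proj_points_def vectors_def intro!: exI[of _ 0])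
          from pt[OF this] have "?F (\<lambda>i. a' i + t / s * b' i) = h 1 (t / s)"
            by simp
          then have "?F (\<lambda>i. s * (a' i + t / s * b' i)) = h s t"
            using False binary_forms_homogeneous[OF h(1), of s 1 "t / s"] unfolding hom by simp
          moreover have "(\<lambda>i. s * (a' i + t / s * b' i)) = (\<lambda>i. s * a' i + t * b' i)"
            using False by (simp add: fun_eq_iff field_simps)
          ultimately show ?thesis
            by simp
        qed
        then show ?thesis
          using h(1) by (simp cong: if_cong)
      qed
    qed
    ultimately show "(\<lambda>s t. ?F (\<lambda>i. s * a i + t * b i)) \<in> binary_forms k"
      by simp
  qed
qed

text \<open>A zero direction gives a constant; a non-zero direction gives an affine embedding after
  truncation to the coordinates \<open>1..m\<close>.\<close>

lemma aff_poly_iff_lines: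
  fixes f :: "'a::{field,finite} mpoly"
  assumes f: "f \<in> mpolys {1..m}"
  shows "(\<forall>L \<in> Emb_A m. poly (comp_A f L) \<in> RS k) \<longleftrightarrow> mpoly_eval f \<in> aff_polys k"
proof
  assume "mpoly_eval f \<in> aff_polys k"
  then have "\<exists>g. degree g \<le> k \<and> (\<forall>t. mpoly_eval f (\<lambda>i. L (1, 0) i + t * L (0, 1) i) = poly g t)"
    for L :: "'a \<times> 'a \<Rightarrow> nat \<Rightarrow> 'a"
    by (simp add: aff_polys_def)
  then show "\<forall>L \<in> Emb_A m. poly (comp_A f L) \<in> RS k"
    unfolding RS_def fun_eq_iff poly_comp_A by blast
next
  assume lines: "\<forall>L \<in> Emb_A m. poly (comp_A f L) \<in> RS k"
  show "mpoly_eval f \<in> aff_polys k"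
    unfolding aff_polys_def
  proof (intro CollectI allI)
    fix a b :: "nat \<Rightarrow> 'a"
    define a' where "a' i = (if i \<in> {1..m} then a i else 0)" for i
    define b' where "b' i = (if i \<in> {1..m} then b i else 0)" for i
    have eq: "mpoly_eval f (\<lambda>i. a i + t * b i) = mpoly_eval f (\<lambda>i. a' i + t * b' i)" for t
      using f unfolding mpolys_def mem_Collect_eq
      by (rule mpoly_eval_cong) (auto simp: a'_def b'_def)
    show "\<exists>g. degree g \<le> k \<and> (\<forall>t. mpoly_eval f (\<lambda>i. a i + t * b i) = poly g t)"
    proof (cases "b' = (\<lambda>_. 0)")
      case True
      then show ?thesis
        by (intro exI[of _ "[:mpoly_eval f a':]"]) (simp add: eq)
    next
      case False
      then obtain j where j: "b' j \<noteq> 0"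
        by blast
      then have "j \<noteq> 0"
        by (metis b'_def atLeastAtMost_iff not_one_le_zero)
      define L where "L p = (\<lambda>i. fst p * a' i + snd p * b' i)" for p
      have upd: "(\<lambda>p. (L p)(0 := fst p)) = (\<lambda>p i. fst p * (a'(0 := 1)) i + snd p * b' i)"
        by (auto simp: fun_eq_iff L_def b'_def)
      \<comment> \<open>The added coordinate determines the first component, and then coordinate
        \<open>j\<close>, where \<open>b'\<close> is non-zero, determines the second.\<close>
      have "inj (\<lambda>p. (L p)(0 := fst p))"
      proof (rule injI)
        fix p p' assume "(L p)(0 := fst p) = (L p')(0 := fst p')"
        from fun_cong[OF this, of 0] fun_cong[OF this, of j] show "p = p'"
          using j \<open>j \<noteq> 0\<close> by (simp add: prod_eq_iff L_def)
      qed
      moreover have "range (\<lambda>p. (L p)(0 := fst p)) \<subseteq> vectors {..m}"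
        by (auto simp: vectors_def L_def a'_def b'_def)
      ultimately have "(\<lambda>p. (L p)(0 := fst p)) \<in> Emb_P m"
        using linear_map_lincomb[of "a'(0 := 1)" b'] unfolding Emb_P_def upd by blast
      then have "L \<in> Emb_A m"
        using linear_map_lincomb[of a' b'] unfolding Emb_A_def
        by (auto simp: L_def[abs_def] vectors_def a'_def b'_def)
      then obtain g where "degree g \<le> k" "poly (comp_A f L) = poly g"
        using lines by (auto simp: RS_def)
      then show ?thesis
        unfolding fun_eq_iff poly_comp_A by (intro exI[of _ g]) (simp add: eq L_def)
    qed
  qed
qed


subsection \<open>Degree sets\<close>

text \<open>No degree condition is imposed, so the sets for different dimensions become comparable
  although \<open>v\<close> changes with \<open>m\<close>. The index set is a parameter to allow
  variables to be dropped and renamed.\<close>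

definition proj_exponents :: "'a::{field,finite} itself \<Rightarrow> nat set \<Rightarrow> nat \<Rightarrow> exponents set" where
  "proj_exponents _ I k = {e \<in> tuples I. reduced CARD('a) e \<and>
    mon e \<in> (proj_forms k :: ((nat \<Rightarrow> 'a) \<Rightarrow> 'a) set)}"

definition aff_exponents :: "'a::{field,finite} itself \<Rightarrow> nat set \<Rightarrow> nat \<Rightarrow> exponents set" where
  "aff_exponents _ I k = {e \<in> tuples I. reduced CARD('a) e \<and>
    mon e \<in> (aff_polys k :: ((nat \<Rightarrow> 'a) \<Rightarrow> 'a) set)}"

lemma finite_proj_exponents: "finite I \<Longrightarrow> finite (proj_exponents TYPE('a::{field,finite}) I k)"
  unfolding proj_exponents_def
  by (rule finite_subset[OF _ finite_reduced[of I "CARD('a)"]]) auto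

lemma finite_aff_exponents: "finite I \<Longrightarrow> finite (aff_exponents TYPE('a::{field,finite}) I k)"
  unfolding aff_exponents_def
  by (rule finite_subset[OF _ finite_reduced[of I "CARD('a)"]]) auto

text \<open>A-reduced tuples are fixed by reduction, and vanishing on the affine points extends to
  all arguments because only the variables \<open>1..m\<close> occur.\<close>

lemma ADeg_eq: "ADeg TYPE('a::{field,finite}) m k = aff_exponents TYPE('a) {1..m} k"
proof -
  interpret scaling_closed "aff_polys k :: ((nat \<Rightarrow> 'a) \<Rightarrow> 'a) set"
    by (rule scaling_closed_aff_polys)
  let ?q = "CARD('a)"
  let ?R = "{d \<in> tuples {1..m}. A_reduced ?q m d}"
  have R: "?R = {d \<in> tuples {1..m}. reduced ?q d}"
    unfolding A_reduced_def reduced_def tuples_def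
    by (auto simp del: One_nat_def) (metis in_keys_iff le0 subsetD)
  have "inj_on (reduce ?q) ?R"
    unfolding R by (rule inj_onI) (simp add: reduce_id)
  moreover have "mpoly_eval f x = 0"
    if f: "keys f \<subseteq> ?R" "\<And>x. x \<in> vectors {1..m} \<Longrightarrow> mpoly_eval f x = 0" for f :: "'a mpoly" and x
  proof -
    have "mpoly_eval f x = mpoly_eval f (\<lambda>i. if i \<in> {1..m} then x i else 0)"
      using f(1) by (intro mpoly_eval_cong[of _ "{1..m}"]) auto
    also have "\<dots> = 0"
      by (intro f(2)) (auto simp: vectors_def)
    finally show ?thesis .
  qed
  moreover have "Lift m k = {restrict (mpoly_eval f) (vectors {1..m}) |f :: 'a mpoly.
      keys f \<subseteq> ?R \<and> mpoly_eval f \<in> aff_polys k}" (is "_ = ?C")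
  proof (intro set_eqI iffI)
    fix F :: "(nat \<Rightarrow> 'a) \<Rightarrow> 'a" assume "F \<in> Lift m k"
    then obtain f where f: "f \<in> mpolys {1..m}" "mpoly_eval f \<in> aff_polys k" "F = ev_A m f"
      using aff_poly_iff_lines unfolding Lift_def by blast
    \<comment> \<open>Reducing every exponent preserves the function; coefficients of exponents with
      equal reduction are added.\<close>
    define g where "g = (\<Sum>d\<in>keys f. Poly_Mapping.single (reduce ?q d) (lookup f d))"
    have "mpoly_eval g = mpoly_eval f"
      by (auto simp: g_def mpoly_eval_sum mon_reduce mpoly_eval_superset[OF finite_keys order_refl, of f])
    moreover have "keys g \<subseteq> ?R"
    proof
      fix d assume "d \<in> keys g"
      then obtain e where "e \<in> keys f" "d = reduce ?q e"
        using keys_sum_single[of "reduce ?q" "lookup f" "keys f"] unfolding g_def by blast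
      then show "d \<in> ?R"
        using f(1) unfolding R by (auto simp: mpolys_def tuples_def reduced_reduce card_field_ge_2)
    qed
    ultimately show "F \<in> ?C"
      using f by (intro CollectI exI[of _ g]) (simp add: ev_A_def)
  next
    fix F assume "F \<in> ?C"
    then obtain f :: "'a mpoly" where f: "keys f \<subseteq> ?R" "mpoly_eval f \<in> aff_polys k" "F = ev_A m f"
      by (auto simp: ev_A_def)
    then have "f \<in> mpolys {1..m}"
      by (auto simp: mpolys_def)
    with f show "F \<in> Lift m k"
      using aff_poly_iff_lines unfolding Lift_def by blast
  qed
  ultimately have "ADeg TYPE('a) m k = {d \<in> ?R. mon d \<in> (aff_polys k :: ((nat \<Rightarrow> 'a) \<Rightarrow> 'a) set)}"
    unfolding ADeg_def ev_A_def[abs_def]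
    by (intro the_degree_set[of "{1..m}"]) auto
  then show ?thesis
    unfolding R by (auto simp: aff_exponents_def)
qed

text \<open>
  Among the exponents of degree \<open>v\<close> with the same reduction, the \<open>P\<close>-reduced one puts the
  whole excess into the leftmost variable that occurs.
\<close>

definition raise_degree :: "nat \<Rightarrow> exponents \<Rightarrow> exponents" where
  "raise_degree v e = e + Poly_Mapping.single (Min (keys e)) (v - total_degree e)"

text \<open>In a P-reduced tuple only the leftmost non-zero entry can be \<open>q\<close> or more.
  Reduction therefore changes no other entry, and the missing degree belongs to that one.\<close>

lemma raise_degree_reduce:
  assumes "d \<in> simplex m v" "P_reduced q m d" "v > 0" "q \<ge> 2"
  shows "raise_degree v (reduce q d) = d"
proof -
  let ?i = "Min (keys d)"
  have keys: "keys d \<subseteq> {..m}" "total_degree d = v"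
    using assms(1) by (auto simp: mem_simplex_iff tuples_def)
  then have ne: "keys d \<noteq> {}"
    using assms(3) total_degree_0_iff by (metis not_gr0)
  then have i: "?i \<in> keys d"
    by (intro Min_in) auto
  have other: "exp_reduce q (lookup d j) = lookup d j" if "j \<noteq> ?i" for j
  proof (rule exp_reduce_id, rule ccontr)
    assume "\<not> lookup d j \<le> q - 1"
    then have j: "q \<le> lookup d j" "j \<in> keys d"
      by (auto simp: in_keys_iff)
    then have "?i < j"
      using that Min_le[OF finite_keys j(2)] by linarith
    then have "lookup d ?i = 0"
      using assms(2) j keys(1) by (auto simp: P_reduced_def)
    then show False
      using i by (simp add: in_keys_iff)
  qed
  have split: "total_degree e = lookup e ?i + (\<Sum>j\<in>keys d - {?i}. lookup e j)" if "keys e = keys d" for e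
    using that i by (simp add: total_degree_def sum.remove)
  have "(\<Sum>j\<in>keys d - {?i}. lookup (reduce q d) j) = (\<Sum>j\<in>keys d - {?i}. lookup d j)"
    by (intro sum.cong) (auto simp: other)
  then have "v - total_degree (reduce q d) = lookup d ?i - exp_reduce q (lookup d ?i)"
    using split[of d] split[of "reduce q d"] keys(2) by simp
  then show ?thesis
    using exp_reduce_le[of q "lookup d ?i"]
    by (intro poly_mapping_eqI) (auto simp: raise_degree_def lookup_add lookup_single when_def other)
qed

text \<open>The missing degree is a multiple of \<open>q - 1\<close> and is added to a positive
  entry, so reduction removes it again.\<close>

lemma raise_degree:
  assumes e: "e \<in> tuples {..m}" "reduced q e" "keys e \<noteq> {}"
    and v: "total_degree e \<le> v" "total_degree e mod (q - 1) = v mod (q - 1)" and q: "q \<ge> 2"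
  shows "raise_degree v e \<in> simplex m v" "P_reduced q m (raise_degree v e)"
    "reduce q (raise_degree v e) = e"
proof -
  let ?i = "Min (keys e)"
  have i: "?i \<in> keys e"
    using e(3) by (intro Min_in) auto
  have lookup: "lookup (raise_degree v e) j =
      (if j = ?i then lookup e j + (v - total_degree e) else lookup e j)" for j
    by (simp add: raise_degree_def lookup_add lookup_single when_def)
  have keys: "keys (raise_degree v e) = keys e"
    using i by (auto simp: in_keys_iff lookup split: if_splits)
  show "raise_degree v e \<in> simplex m v"
    using e(1) v(1) keys by (simp add: mem_simplex_iff tuples_def)
      (simp add: raise_degree_def total_degree_add)
  show "P_reduced q m (raise_degree v e)"
    unfolding P_reduced_def
  proof (intro allI impI)
    fix j assume j: "j \<le> m" "q \<le> lookup (raise_degree v e) j"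
    have le: "lookup e l \<le> q - 1" for l
      using e(2) by (simp add: reduced_def)
    have "j = ?i"
      using j le[of j] q by (auto simp: lookup split: if_splits)
    moreover have "lookup e l = 0" if "l < ?i" for l
      using that Min_le[OF finite_keys, of l e] by (meson in_keys_iff not_le)
    ultimately show "(\<forall>l<j. lookup (raise_degree v e) l = 0) \<and>
        (\<forall>l\<in>{j<..m}. lookup (raise_degree v e) l \<le> q - 1)"
      using le by (auto simp: lookup)
  qed
  show "reduce q (raise_degree v e) = e"
  proof (rule poly_mapping_eqI)
    fix j
    have id: "exp_reduce q (lookup e j) = lookup e j"
      using e(2) by (intro exp_reduce_id) (simp add: reduced_def)
    have "(q - 1) dvd v - total_degree e"
      using v by (metis mod_eq_dvd_iff_nat)
    then obtain c where "v - total_degree e = c * (q - 1)"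
      by (metis dvd_def mult.commute)
    then have "exp_reduce q (lookup e ?i + (v - total_degree e)) = exp_reduce q (lookup e ?i)"
      using i by (simp only: exp_reduce_add_mult in_keys_iff)
    then show "lookup (reduce q (raise_degree v e)) j = lookup e j"
      using id by (cases "j = ?i") (simp_all add: lookup)
  qed
qed

text \<open>On P-reduced tuples of degree \<open>v\<close> reduction has the left inverse
  \<open>raise_degree v\<close>, hence is injective. Homogeneity extends vanishing from the standard
  representatives to all vectors.\<close>

lemma PDeg_eq:
  fixes m k :: nat
  assumes "k \<ge> 1"
  defines "v \<equiv> k + (m - 1) * (CARD('a::{field,finite}) - 1)"
  shows "PDeg TYPE('a) m k = {d \<in> simplex m v. P_reduced CARD('a) m d \<and>
    mon d \<in> (proj_forms k :: ((nat \<Rightarrow> 'a) \<Rightarrow> 'a) set)}"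
proof -
  interpret scaling_closed "proj_forms k :: ((nat \<Rightarrow> 'a) \<Rightarrow> 'a) set"
    by (rule scaling_closed_proj_forms)
  let ?q = "CARD('a)"
  let ?R = "{d \<in> simplex m v. P_reduced ?q m d}"
  have v: "v > 0" "v mod (?q - 1) = k mod (?q - 1)"
    unfolding v_def using assms(1) by (auto simp only: mod_mult_self1)
  have iff: "(\<forall>L \<in> Emb_P m. ev_P 1 (comp_P f L) \<in> PRS k) \<longleftrightarrow> mpoly_eval f \<in> proj_forms k"
    if "f \<in> hom_polys m v" for f :: "'a mpoly"
    using proj_form_iff_lines[OF that] v assms(1) by simp
  have "inj_on (reduce ?q) ?R"
    by (rule inj_on_inverseI[of _ "raise_degree v"])
      (auto intro: raise_degree_reduce v card_field_ge_2)
  moreover have "?R \<subseteq> tuples {..m}"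
    by (auto simp: mem_simplex_iff)
  moreover have "mpoly_eval f x = 0"
    if f: "keys f \<subseteq> ?R" "\<And>x. x \<in> proj_points m \<Longrightarrow> mpoly_eval f x = 0" for f :: "'a mpoly" and x
  proof -
    define y where "y i = (if i \<le> m then x i else 0)" for i
    have hom: "f \<in> hom_polys m v"
      using f(1) by (auto simp: hom_polys_def)
    have "mpoly_eval f x = mpoly_eval f y"
      using hom_polys_subset_tuples[OF hom] by (rule mpoly_eval_cong) (simp add: y_def)
    also have "\<dots> = 0"
    proof (cases "y = (\<lambda>_. 0)")
      case True
      then show ?thesis
        using mpoly_eval_homogeneous[OF hom, of 0 y] v(1) by (simp add: power_0_left)
    next
      case False
      \<comment> \<open>Dividing by the leftmost non-zero coordinate gives the standard
        representative.\<close>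
      define i where "i = (LEAST i. y i \<noteq> 0)"
      have i: "y i \<noteq> 0"
        using False LeastI_ex[of "\<lambda>i. y i \<noteq> 0"] by (auto simp: i_def)
      have less: "y j = 0" if "j < i" for j
        using not_less_Least[OF that[unfolded i_def]] by simp
      have "i \<le> m"
        using i by (auto simp: y_def split: if_splits)
      then have "(\<lambda>j. y j / y i) \<in> proj_points m"
        using i less by (auto simp: proj_points_def vectors_def y_def intro!: exI[of _ i])
      then have "mpoly_eval f (\<lambda>j. y i * (y j / y i)) = 0"
        using f(2) by (simp only: mpoly_eval_homogeneous[OF hom]) simp
      then show ?thesis
        using i by simp
    qed
    finally show ?thesis .
  qed
  moreover have "PLift m k = {restrict (mpoly_eval f) (proj_points m) |f :: 'a mpoly.
      keys f \<subseteq> ?R \<and> mpoly_eval f \<in> proj_forms k}" (is "_ = ?C")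
  proof (intro set_eqI iffI)
    fix F :: "(nat \<Rightarrow> 'a) \<Rightarrow> 'a" assume "F \<in> PLift m k"
    then obtain f where f: "f \<in> hom_polys m v" "mpoly_eval f \<in> proj_forms k" "F = ev_P m f"
      using iff unfolding PLift_def v_def[symmetric] by blast
    \<comment> \<open>The P-reduced exponent of the same degree that defines the same monomial
      function.\<close>
    let ?p = "\<lambda>d. raise_degree v (reduce ?q d)"
    have p: "?p d \<in> ?R" "reduce ?q (?p d) = reduce ?q d" if "d \<in> keys f" for d
    proof -
      have d: "keys d \<subseteq> {..m}" "total_degree d = v"
        using that f(1) unfolding hom_polys_def by (auto simp: mem_simplex_iff tuples_def dest!: subsetD)
      obtain c where c: "v = total_degree (reduce ?q d) + c * (?q - 1)"
        using total_degree_reduce_decomp[of d] d(2) by blast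
      have *: "reduce ?q d \<in> tuples {..m}" "reduced ?q (reduce ?q d)" "keys (reduce ?q d) \<noteq> {}"
        "total_degree (reduce ?q d) \<le> v" "total_degree (reduce ?q d) mod (?q - 1) = v mod (?q - 1)"
        using d v(1) total_degree_0_iff[of d]
        by (auto simp: tuples_def reduced_reduce card_field_ge_2 c simp del: One_nat_def)
      show "?p d \<in> ?R" "reduce ?q (?p d) = reduce ?q d"
        using raise_degree[OF * card_field_ge_2] by auto
    qed
    define g where "g = (\<Sum>d\<in>keys f. Poly_Mapping.single (?p d) (lookup f d))"
    have "mon (?p d) x = mon d x" if "d \<in> keys f" for d and x :: "nat \<Rightarrow> 'a"
      by (metis p(2)[OF that] mon_reduce)
    then have "mpoly_eval g = mpoly_eval f"
      by (auto simp: g_def mpoly_eval_sum mpoly_eval_superset[OF finite_keys order_refl, of f])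
    moreover have "keys g \<subseteq> ?R"
    proof
      fix d assume "d \<in> keys g"
      then obtain e where "e \<in> keys f" "d = ?p e"
        using keys_sum_single[of ?p "lookup f" "keys f"] unfolding g_def by blast
      then show "d \<in> ?R"
        using p(1) by simp
    qed
    ultimately show "F \<in> ?C"
      using f by (intro CollectI exI[of _ g]) (simp add: ev_P_def)
  next
    fix F assume "F \<in> ?C"
    then obtain f :: "'a mpoly" where f: "keys f \<subseteq> ?R" "mpoly_eval f \<in> proj_forms k" "F = ev_P m f"
      by (auto simp: ev_P_def)
    then have "f \<in> hom_polys m v"
      by (auto simp: hom_polys_def)
    with f show "F \<in> PLift m k"
      using iff unfolding PLift_def v_def[symmetric] by blast
  qed
  ultimately have "PDeg TYPE('a) m k = {d \<in> ?R. mon d \<in> (proj_forms k :: ((nat \<Rightarrow> 'a) \<Rightarrow> 'a) set)}"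
    unfolding PDeg_def v_def[symmetric] ev_P_def[abs_def]
    by (intro the_degree_set[of "{..m}"]) auto
  then show ?thesis
    by auto
qed

section \<open>Splitting off the variable of index 0\<close>

lemma mod_add_right_cancel_nat:
  fixes a b c n :: nat
  assumes "(a + c) mod n = (b + c) mod n"
  shows "a mod n = b mod n"
proof -
  have "int (a + c) mod int n = int (b + c) mod int n"
    using assms by (simp only: flip: zmod_int)
  then have "int a mod int n = int b mod int n"
    by (simp add: mod_eq_dvd_iff)
  then show ?thesis
    by (simp only: of_nat_eq_iff flip: zmod_int)
qed

text \<open>A positive difference would be a multiple of \<open>n\<close> smaller than
  \<open>n\<close>.\<close>

lemma mod_less_add_imp_le:
  fixes a b n :: nat
  assumes "a mod n = b mod n" "a < b + n"
  shows "a \<le> b"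
proof (rule ccontr)
  assume "\<not> a \<le> b"
  then have "n dvd a - b" "0 < a - b" "a - b < n"
    using assms by (auto simp: mod_eq_dvd_iff_nat)
  then show False
    using nat_dvd_not_less by blast
qed

lemma exponents_split_0:
  assumes "e \<in> tuples {..m}"
  shows "e = Poly_Mapping.single 0 (lookup e 0) + Poly_Mapping.update 0 0 e"
    "Poly_Mapping.update 0 0 e \<in> tuples {1..m}"
proof -
  show "e = Poly_Mapping.single 0 (lookup e 0) + Poly_Mapping.update 0 0 e"
    by (intro poly_mapping_eqI) (auto simp: lookup_add lookup_single lookup_update when_def)
  show "Poly_Mapping.update 0 0 e \<in> tuples {1..m}"
    using assms by (auto simp: tuples_def keys_update Suc_le_eq)
qed

lemma reduced_update: "reduced q e \<Longrightarrow> reduced q (Poly_Mapping.update i 0 e)"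
  by (simp add: reduced_def lookup_update)

lemma proj_exponents_dehomogenize:
  assumes "e \<in> proj_exponents TYPE('a::{field,finite}) {..m} k" "lookup e 0 > 0" "k \<ge> 1"
  shows "Poly_Mapping.update 0 0 e \<in> aff_exponents TYPE('a) {1..m} (k - 1)"
proof -
  have e: "e \<in> tuples {..m}" "reduced CARD('a) e" "mon e \<in> (proj_forms k :: ((nat \<Rightarrow> 'a) \<Rightarrow> 'a) set)"
    using assms(1) by (auto simp: proj_exponents_def)
  have "mon (Poly_Mapping.update 0 0 e) \<in> (aff_polys (k - 1) :: ((nat \<Rightarrow> 'a) \<Rightarrow> 'a) set)"
    using e(3) exponents_split_0(1)[OF e(1)] assms(2,3)
    by (intro aff_poly_dehomogenize[of "lookup e 0"]) (auto simp: lookup_update)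
  then show ?thesis
    using exponents_split_0(2)[OF e(1)] reduced_update[OF e(2)] by (simp add: aff_exponents_def)
qed

lemma proj_exponents_total_degree:
  assumes "e \<in> proj_exponents TYPE('a::{field,finite}) I k" "k \<ge> 1"
  shows "total_degree e > 0" "total_degree e mod (CARD('a) - 1) = k mod (CARD('a) - 1)"
proof -
  have eq: "exp_reduce CARD('a) (total_degree e) = exp_reduce CARD('a) k"
    using assms by (auto simp: proj_exponents_def intro: exp_reduce_total_degree_proj_form)
  show "total_degree e > 0"
    using assms(2) eq exp_reduce_eq_0_iff by (metis not_one_le_zero not_gr0)
  show "total_degree e mod (CARD('a) - 1) = k mod (CARD('a) - 1)"
    using eq exp_reduce_mod by metis
qed

text \<open>Guarantees that a reduced exponent can be raised to degree \<open>v\<close>. By the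
  congruence with \<open>k\<close>, a strict bound that is weaker by \<open>q - 1\<close> suffices:
  if the entry at 0 vanishes, count the other \<open>m\<close> entries; otherwise apply the affine
  bound to the dehomogenized exponent.\<close>

lemma proj_exponents_total_degree_le:
  assumes e: "e \<in> proj_exponents TYPE('a::{field,finite}) {..m} k"
    and k: "1 \<le> k" "k \<le> CARD('a) - 1" and m: "m \<ge> 1"
  shows "total_degree e \<le> k + (m - 1) * (CARD('a) - 1)"
proof (rule mod_less_add_imp_le)
  let ?q = "CARD('a)"
  have e': "e \<in> tuples {..m}" "reduced ?q e"
    using e by (auto simp: proj_exponents_def)
  show "total_degree e mod (?q - 1) = (k + (m - 1) * (?q - 1)) mod (?q - 1)"
    using proj_exponents_total_degree(2)[OF e k(1)] by (simp only: mod_mult_self1)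
  let ?e = "Poly_Mapping.update 0 0 e"
  have split: "total_degree e = lookup e 0 + total_degree ?e"
    using exponents_split_0(1)[OF e'(1)] total_degree_add[of "Poly_Mapping.single 0 (lookup e 0)" ?e]
    by simp
  show "total_degree e < k + (m - 1) * (?q - 1) + (?q - 1)"
  proof (cases "lookup e 0 = 0")
    case True
    have "total_degree ?e = (\<Sum>i\<in>{1..m}. lookup ?e i)"
      using exponents_split_0(2)[OF e'(1)] by (intro total_degree_superset) (auto simp: tuples_def)
    also have "\<dots> \<le> card {1..m} * (?q - 1)"
      using sum_bounded_above[of "{1..m}" "lookup ?e" "?q - 1"] reduced_update[OF e'(2)]
      by (simp add: reduced_def)
    also have "\<dots> = (m - 1) * (?q - 1) + (?q - 1)"
      using m by (cases m) auto
    finally show ?thesis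
      using split True k(1) by linarith
  next
    case False
    have "?e \<in> aff_exponents TYPE('a) {1..m} (k - 1)"
      using proj_exponents_dehomogenize[OF e] False k(1) by simp
    then have "total_degree ?e \<le> (k - 1) + (card {1..m} - 1) * (?q - 1)"
      using k m by (intro total_degree_le_aff_poly[where 'a='a]) (auto simp: aff_exponents_def)
    moreover have "lookup e 0 \<le> ?q - 1"
      using e'(2) by (simp add: reduced_def)
    ultimately show ?thesis
      unfolding split card_atLeastAtMost using k(1) by (simp only: diff_Suc_1)
  qed
qed

text \<open>The inverse is \<open>raise_degree v\<close>, applicable because of the congruence and
  the bound on the total degree.\<close>

lemma bij_betw_reduce_PDeg:
  fixes m k :: nat
  assumes k: "1 \<le> k" "k \<le> CARD('a::{field,finite}) - 1" and m: "m \<ge> 1"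
  shows "bij_betw (reduce CARD('a)) (PDeg TYPE('a) m k) (proj_exponents TYPE('a) {..m} k)"
proof -
  let ?q = "CARD('a)"
  define v where "v = k + (m - 1) * (?q - 1)"
  have v: "v > 0" "v mod (?q - 1) = k mod (?q - 1)"
    unfolding v_def using k(1) by (auto simp only: mod_mult_self1)
  have mon_eq: "mon (reduce ?q d) = (mon d :: (nat \<Rightarrow> 'a) \<Rightarrow> 'a)" for d
    by (rule ext) (rule mon_reduce)
  note PDeg = PDeg_eq[OF k(1), where 'a='a and m=m, folded v_def]
  show ?thesis
  proof (rule bij_betw_byWitness[where f' = "raise_degree v"])
    show "\<forall>d\<in>PDeg TYPE('a) m k. raise_degree v (reduce ?q d) = d"
      using v(1) by (auto simp: PDeg intro: raise_degree_reduce card_field_ge_2)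
    have raise: "raise_degree v e \<in> simplex m v" "P_reduced ?q m (raise_degree v e)"
      "reduce ?q (raise_degree v e) = e" if e: "e \<in> proj_exponents TYPE('a) {..m} k" for e
    proof -
      have "e \<in> tuples {..m}" "reduced ?q e" "keys e \<noteq> {}" "total_degree e \<le> v"
        "total_degree e mod (?q - 1) = v mod (?q - 1)"
        using e v(2) proj_exponents_total_degree[OF e k(1)]
          proj_exponents_total_degree_le[OF e k m] total_degree_0_iff[of e]
        by (auto simp: proj_exponents_def v_def)
      from raise_degree[OF this card_field_ge_2] show "raise_degree v e \<in> simplex m v"
        "P_reduced ?q m (raise_degree v e)" "reduce ?q (raise_degree v e) = e" .
    qed
    show "\<forall>e\<in>proj_exponents TYPE('a) {..m} k. reduce ?q (raise_degree v e) = e"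
      using raise(3) by blast
    show "reduce ?q ` PDeg TYPE('a) m k \<subseteq> proj_exponents TYPE('a) {..m} k"
      by (auto simp: PDeg proj_exponents_def mon_eq tuples_def mem_simplex_iff
          intro: reduced_reduce card_field_ge_2)
    show "raise_degree v ` proj_exponents TYPE('a) {..m} k \<subseteq> PDeg TYPE('a) m k"
    proof
      fix d assume "d \<in> raise_degree v ` proj_exponents TYPE('a) {..m} k"
      then obtain e where e: "e \<in> proj_exponents TYPE('a) {..m} k" "d = raise_degree v e"
        by blast
      have "mon d = (mon e :: (nat \<Rightarrow> 'a) \<Rightarrow> 'a)"
        using mon_eq[of d] raise(3)[OF e(1)] e(2) by simp
      then show "d \<in> PDeg TYPE('a) m k"
        using raise[OF e(1)] e by (simp add: PDeg proj_exponents_def)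
    qed
  qed
qed

lemma bij_betw_proj_exponents_aff_exponents:
  fixes m k :: nat
  assumes k: "1 \<le> k"
  shows "bij_betw (Poly_Mapping.update 0 0)
    {e \<in> proj_exponents TYPE('a::{field,finite}) {..m} k. lookup e 0 > 0}
    (aff_exponents TYPE('a) {1..m} (k - 1))"
proof -
  let ?q = "CARD('a)"
  let ?P = "{e \<in> proj_exponents TYPE('a) {..m} k. lookup e 0 > 0}"
  let ?A = "aff_exponents TYPE('a) {1..m} (k - 1)"
  have q: "?q \<ge> 2"
    by (rule card_field_ge_2)
  \<comment> \<open>Since \<open>q - 2\<close> is congruent to -1 modulo \<open>q - 1\<close>, this
    represents \<open>k - total_degree e\<close> in \<open>{1..q - 1}\<close> without subtraction;
    \<open>k >= 1\<close> keeps the argument positive.\<close>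
  define n where "n e = exp_reduce ?q (k + total_degree e * (?q - 2))" for e
  have n_pos: "n e > 0" for e
    using k by (simp add: n_def exp_reduce_def)
  have cancel: "(k + t * (?q - 2) + t) mod (?q - 1) = k mod (?q - 1)" for t
  proof -
    have "?q - 1 = (?q - 2) + 1"
      using q by simp
    then have "k + t * (?q - 2) + t = k + t * (?q - 1)"
      by (simp only: distrib_left mult_1_right add.assoc)
    then show ?thesis
      by (simp only: mod_mult_self1)
  qed
  have n_mod: "(n e + total_degree e) mod (?q - 1) = k mod (?q - 1)" for e
    by (metis n_def cancel exp_reduce_mod mod_add_left_eq)
  have in_P: "Poly_Mapping.single 0 (n e) + e \<in> ?P" "lookup e 0 = 0" if e: "e \<in> ?A" for e
  proof -
    have e': "keys e \<subseteq> {1..m}" "reduced ?q e" "mon e \<in> (aff_polys (k - 1) :: ((nat \<Rightarrow> 'a) \<Rightarrow> 'a) set)"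
      using e by (auto simp: aff_exponents_def tuples_def)
    show e0: "lookup e 0 = 0"
      using e'(1) by (metis atLeastAtMost_iff in_keys_iff not_one_le_zero subsetD)
    have "mon (Poly_Mapping.single 0 (n e) + e) \<in> (proj_forms k :: ((nat \<Rightarrow> 'a) \<Rightarrow> 'a) set)"
      using e'(3) n_pos[of e] e0 k n_mod[of e]
      by (intro proj_form_homogenize exp_reduce_cong) auto
    moreover have "Poly_Mapping.single 0 (n e) + e \<in> tuples {..m}"
      using e'(1) by (auto simp: tuples_def dest!: subsetD[OF Poly_Mapping.keys_add] split: if_splits)
    moreover have "reduced ?q (Poly_Mapping.single 0 (n e) + e)"
      using e'(2) e0 exp_reduce_le_card[OF q]
      by (auto simp: reduced_def lookup_add lookup_single when_def n_def simp del: One_nat_def)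
    ultimately show "Poly_Mapping.single 0 (n e) + e \<in> ?P"
      using n_pos[of e] by (simp add: proj_exponents_def lookup_add)
  qed
  show ?thesis
  proof (rule bij_betw_byWitness[where f' = "\<lambda>e. Poly_Mapping.single 0 (n e) + e"])
    show "\<forall>e\<in>?P. Poly_Mapping.single 0 (n (Poly_Mapping.update 0 0 e)) + Poly_Mapping.update 0 0 e = e"
    proof
      fix e assume e: "e \<in> ?P"
      then have tup: "e \<in> tuples {..m}"
        by (auto simp: proj_exponents_def)
      let ?e = "Poly_Mapping.update 0 0 e"
      note split = exponents_split_0(1)[OF tup]
      let ?t = "total_degree ?e"
      have "total_degree e = lookup e 0 + ?t"
        using split total_degree_add[of "Poly_Mapping.single 0 (lookup e 0)" ?e] by simp
      then have "(lookup e 0 + ?t) mod (?q - 1) = k mod (?q - 1)"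
        using proj_exponents_total_degree(2)[where 'a='a, of e "{..m}" k] e k by simp
      also have "\<dots> = (n ?e + ?t) mod (?q - 1)"
        by (simp only: n_mod)
      finally have "lookup e 0 mod (?q - 1) = n ?e mod (?q - 1)"
        by (rule mod_add_right_cancel_nat)
      \<comment> \<open>Both numbers lie in \<open>{1..q - 1}\<close>, so they are their own
        representatives and the congruence forces equality.\<close>
      then have "exp_reduce ?q (lookup e 0) = exp_reduce ?q (n ?e)"
        using e n_pos by (intro exp_reduce_cong) auto
      moreover have "exp_reduce ?q (lookup e 0) = lookup e 0"
        using e by (intro exp_reduce_id) (auto simp: proj_exponents_def reduced_def)
      moreover have "exp_reduce ?q (n ?e) = n ?e"
        unfolding n_def by (intro exp_reduce_id exp_reduce_le_card[OF q])
      ultimately show "Poly_Mapping.single 0 (n ?e) + ?e = e"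
        using split by simp
    qed
    show "\<forall>e\<in>?A. Poly_Mapping.update 0 0 (Poly_Mapping.single 0 (n e) + e) = e"
      by (auto intro!: poly_mapping_eqI simp: lookup_update lookup_add lookup_single when_def in_P(2))
    show "Poly_Mapping.update 0 0 ` ?P \<subseteq> ?A"
      using k by (auto simp del: One_nat_def intro!: proj_exponents_dehomogenize)
    show "(\<lambda>e. Poly_Mapping.single 0 (n e) + e) ` ?A \<subseteq> ?P"
      using in_P(1) by blast
  qed
qed

text \<open>Renaming variables preserves \<open>proj_forms k\<close> because its vectors
  \<open>a\<close> and \<open>b\<close> are arbitrary. For an involution, the renaming of exponents
  is its own inverse.\<close>

lemma card_proj_exponents_permute:
  assumes p: "\<And>i. p (p i) = i"
  shows "card (proj_exponents TYPE('a::{field,finite}) (p ` I) k) = card (proj_exponents TYPE('a) I k)"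
proof -
  have inj: "inj p"
    by (metis injI p)
  have lookup: "lookup (Poly_Mapping.map_key p e) i = lookup e (p i)" for e :: exponents and i
    by (simp add: map_key.rep_eq[OF inj])
  have mem: "Poly_Mapping.map_key p e \<in> proj_exponents TYPE('a) (p ` I) k"
    if e: "e \<in> proj_exponents TYPE('a) I k" for e I
  proof -
    have keys: "keys (Poly_Mapping.map_key p e) = p ` keys e"
      unfolding keys_map_key[OF inj] using p by (auto simp: image_iff) metis
    have mon: "mon (Poly_Mapping.map_key p e) x = mon e (\<lambda>i. x (p i))" for x :: "nat \<Rightarrow> 'a"
      unfolding mon_def keys using inj by (subst prod.reindex) (auto simp: lookup p inj_on_def)
    have "mon e \<in> (proj_forms k :: ((nat \<Rightarrow> 'a) \<Rightarrow> 'a) set)"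
      using e by (simp add: proj_exponents_def)
    then have "(\<lambda>s t. mon e (\<lambda>i. s * a (p i) + t * b (p i))) \<in> binary_forms k" for a b :: "nat \<Rightarrow> 'a"
      by (simp add: proj_forms_def)
    then have "mon (Poly_Mapping.map_key p e) \<in> (proj_forms k :: ((nat \<Rightarrow> 'a) \<Rightarrow> 'a) set)"
      by (simp add: proj_forms_def mon)
    then show ?thesis
      using e by (auto simp: proj_exponents_def tuples_def keys reduced_def lookup)
  qed
  have inv: "Poly_Mapping.map_key p (Poly_Mapping.map_key p e) = e" for e :: exponents
    by (rule poly_mapping_eqI) (simp add: lookup p)
  have "p ` p ` I = I"
    by (simp add: image_comp comp_def p)
  then have "bij_betw (Poly_Mapping.map_key p) (proj_exponents TYPE('a) (p ` I) k) (proj_exponents TYPE('a) I k)"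
    using mem[of _ I] mem[of _ "p ` I"]
    by (intro bij_betw_byWitness[where f' = "Poly_Mapping.map_key p"]) (auto simp: inv)
  then show ?thesis
    by (rule bij_betw_same_card)
qed

text \<open>Exponents are sorted by whether the entry at 0 vanishes; the positive case is the affine
  one.\<close>

lemma card_proj_exponents:
  fixes m k :: nat
  assumes "1 \<le> k" "m \<ge> 1"
  shows "card (proj_exponents TYPE('a::{field,finite}) {..m} k) =
    card (proj_exponents TYPE('a) {..m - 1} k) + card (aff_exponents TYPE('a) {1..m} (k - 1))"
proof -
  let ?E = "\<lambda>I. proj_exponents TYPE('a) I k"
  let ?P = "{e \<in> ?E {..m}. lookup e 0 > 0}"
  have "?E {..m} = ?E {1..m} \<union> ?P"
  proof -
    have "keys e \<subseteq> {1..m} \<longleftrightarrow> keys e \<subseteq> {..m} \<and> lookup e 0 = 0" for e :: exponents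
      by (auto simp: in_keys_iff Suc_le_eq subset_eq) (metis gr0I)
    then show ?thesis
      by (auto simp: proj_exponents_def tuples_def)
  qed
  moreover have "?E {1..m} \<inter> ?P = {}"
    by (auto simp: proj_exponents_def tuples_def in_keys_iff subset_eq)
  moreover have "finite (?E {1..m})" "finite ?P"
    by (auto intro: finite_subset[OF _ finite_proj_exponents[of "{..m}"]] finite_proj_exponents)
  ultimately have "card (?E {..m}) = card (?E {1..m}) + card ?P"
    by (metis card_Un_disjoint)
  also have "card ?P = card (aff_exponents TYPE('a) {1..m} (k - 1))"
    using bij_betw_proj_exponents_aff_exponents[OF assms(1)] by (rule bij_betw_same_card)
  \<comment> \<open>Swapping 0 and \<open>m\<close> turns the remaining variables into those of the
    projective space of dimension \<open>m - 1\<close>.\<close>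
  also have "{1..m} = Transposition.transpose 0 m ` {..m - 1}"
  proof (intro set_eqI iffI)
    fix i assume "i \<in> {1..m}"
    then show "i \<in> Transposition.transpose 0 m ` {..m - 1}"
      by (intro image_eqI[of _ _ "Transposition.transpose 0 m i"])
        (auto simp: Transposition.transpose_def)
  qed (use assms(2) in \<open>auto simp: Transposition.transpose_def split: if_splits\<close>)
  then have "card (?E {1..m}) = card (?E {..m - 1})"
    by (simp only: card_proj_exponents_permute[OF transpose_involutory])
  finally show ?thesis .
qed

theorem theorem26:
  fixes m k :: nat
  assumes "m \<ge> 2"
    and "1 \<le> k" and "k \<le> CARD('a::{field,finite}) - 1"
  shows "\<exists>\<phi>. bij_betw \<phi> (PDeg TYPE('a) m k) (PDeg TYPE('a) (m - 1) k <+> ADeg TYPE('a) m (k - 1))"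
proof -
  let ?E = "\<lambda>m. proj_exponents TYPE('a) {..m} k"
  have bij: "bij_betw (reduce CARD('a)) (PDeg TYPE('a) n k) (?E n)" if "n \<ge> 1" for n
    using bij_betw_reduce_PDeg assms that by blast
  have fin: "finite (PDeg TYPE('a) n k)" if "n \<ge> 1" for n
    using bij_betw_finite[OF bij[OF that]] finite_proj_exponents by blast
  have finA: "finite (ADeg TYPE('a) m (k - 1))"
    by (simp add: ADeg_eq finite_aff_exponents)
  \<comment> \<open>All sets involved are finite, so it suffices to compare cardinalities through
    the reduced exponents.\<close>
  have "card (PDeg TYPE('a) m k) = card (?E m)"
    using assms by (intro bij_betw_same_card[OF bij]) simp
  also have "\<dots> = card (?E (m - 1)) + card (aff_exponents TYPE('a) {1..m} (k - 1))"
    using assms by (intro card_proj_exponents) auto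
  \<comment> \<open>Here \<open>m >= 2\<close> is used: the reduction bijection is applied in
    dimension \<open>m - 1\<close>, which must be at least 1.\<close>
  also have "card (?E (m - 1)) = card (PDeg TYPE('a) (m - 1) k)"
    using assms by (intro bij_betw_same_card[OF bij, symmetric]) simp
  finally have "card (PDeg TYPE('a) m k) = card (PDeg TYPE('a) (m - 1) k <+> ADeg TYPE('a) m (k - 1))"
    using assms fin finA by (simp add: card_Plus ADeg_eq)
  then show ?thesis
    using assms fin finA by (intro finite_same_card_bij) auto
qed

end
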